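(* Let $\beta<\eta<\alpha$. If $$K\,\mathrm{Lip}_uG\,\Big(\frac{1}{\eta-\beta}+\frac{1}{\alpha-\eta}\Big)<1,$$ then there exists a Lipschitz unstable manifold for the random partial differential equation $$\frac{du}{dt}=Au+z(\theta_t\omega)u+G(\theta_t\omega,u),\qquad u(0)=u_0\in H,$$ which is given by $$M^u(\omega)=\{\xi+h^u(\xi,\omega)\;|\;\xi\in H^+\},\qquad\omega\in\Omega,$$ where $M^u(\omega)=\{u_0\in H\;|\;u(\cdot,\omega,u_0)\in C_\eta^-\}$ and, for each $\omega\in\Omega$, $h^u(\cdot,\omega):H^+\to H^-$ is a Lipschitz continuous mapping with $h^u(0,\omega)=0$. Moreover, $\tilde M^u(\omega)=T^{-1}(\omega,M^u(\omega))$ is a Lipschitz unstable manifold of the stochastic partial differential equation $$du=Au\,dt+F(u)\,dt+\frac u2\,dt+u\,dW,$$ i.e. of the random dynamical system $\hat u$ generated by it.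
   Context: **State space and linear part.** $H$ is an infinite dimensional separable Hilbert space with norm $|\cdot|$. The linear operator $A:D(A)\to H$ generates a strongly continuous semigroup $e^{At}$ on $H$ satisfying an exponential dichotomy with exponents $\alpha>\beta$ and bound $K$: there is a continuous projection $P^+$ on $H$ such that (i) $P^+e^{At}=e^{At}P^+$; (ii) for $t\ge 0$ the restriction $e^{At}|_{R(P^+)}$ is an isomorphism of the range $R(P^+)$ onto itself, and $e^{At}$ for $t<0$ is defined on $R(P^+)$ as the inverse map; (iii) $|e^{At}P^+x|\le Ke^{\alpha t}|x|$ for $t\le 0$ and $|e^{At}P^-x|\le Ke^{\beta t}|x|$ for $t\ge 0$, where $P^-=I-P^+$. Put $H^-=P^-H$ (stable subspace), $H^+=P^+H$ (unstable subspace), so $H=H^+\oplus H^-$. **Nonlinearity.** $F:H\to H$ satisfies $F(0)=0$ and $|P^\pm(F(x_1)-F(x_2))|\le \mathrm{Lip}F\,|x_1-x_2|$ for all $x_1,x_2\in H$, with Lipschitz constant $\mathrm{Lip}F>0$. **Noise.** Let $C_0(\mathbb R,\mathbb R)$ be the continuous functions $\omega:\mathbb R\to\mathbb R$ with $\omega(0)=0$, with the compact open topology, its Borel $\sigma$-algebra and the (two-sided) Wiener measure $\mathbb P$, and let $\theta_t\omega=\omega(\cdot+t)-\omega(t)$. $\Omega\subset C_0(\mathbb R,\mathbb R)$ is a Borel set of $\mathbb P$-measure one with $\theta_t\Omega=\Omega$ for all $t\in\mathbb R$, such that for $\omega\in\Omega$: $\omega(t)/t\to0$ as $t\to\pm\infty$;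 $z(\omega)=-\int_{-\infty}^0e^\tau\omega(\tau)\,d\tau$ exists; $t\mapsto z(\theta_t\omega)$ is continuous (it is the stationary solution of $dz+z\,dt=dW$, $W(t)=\omega(t)$); and $|z(\theta_t\omega)|/|t|\to0$, $\frac1t\int_0^tz(\theta_\tau\omega)\,d\tau\to0$ as $t\to\pm\infty$. $\mathcal F$ is the trace on $\Omega$ of the Borel $\sigma$-algebra, and $\mathbb P$ is restricted to $\mathcal F$. **Random PDE.** $G(\omega,u)=e^{-z(\omega)}F(e^{z(\omega)}u)$. For every $\omega$, $G(\omega,\cdot)$ satisfies the same Lipschitz estimate as $F$, and $\mathrm{Lip}_uG$ $(=\mathrm{Lip}F)$ denotes the Lipschitz constant of $G$ with respect to $u$: $|P^\pm(G(\omega,x_1)-G(\omega,x_2))|\le\mathrm{Lip}_uG\,|x_1-x_2|$. For each $\omega\in\Omega$ and $u_0\in H$, $u(t,\omega,u_0)$, $t\ge0$, is the unique mild solution $$u(t)=e^{At+\int_0^tz(\theta_\tau\omega)d\tau}u_0+\int_0^te^{A(t-s)+\int_s^tz(\theta_r\omega)dr}G(\theta_s\omega,u(s))\,ds.$$ The map $(t,\omega,x)\mapsto u(t,\omega,x)$ is a random dynamical system on $H$ over $\theta$ (measurable, $u(0,\omega,x)=x$, $u(t_1+t_2,\omega,x)=u(t_2,\theta_{t_1}\omega,u(t_1,\omega,x))$). **Stochastic PDE.** The stochastic equation (Ito form; in Stratonovich form $\frac{du}{dt}=Au+F(u)+u\,\dot W$, $W$ the standard real Wiener process $W(t)=\omega(t)$)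 generates the random dynamical system $$\hat u(t,\omega,x)=T^{-1}(\theta_t\omega,u(t,\omega,T(\omega,x))),\qquad T(\omega,x)=xe^{-z(\omega)},\quad T^{-1}(\omega,x)=xe^{z(\omega)}.$$ **Function space.** For $\beta<\eta<\alpha$ (and given $\omega$), $C_\eta^-$ is the Banach space of continuous $\phi:(-\infty,0]\to H$ with $|\phi|_{C_\eta^-}=\sup_{t\le0}e^{-\eta t-\int_0^tz(\theta_\tau\omega)d\tau}|\phi(t)|<\infty$. The condition $u(\cdot,\omega,u_0)\in C_\eta^-$ means that there is a function $u\in C_\eta^-$ with $u(0)=u_0$ which is a mild solution of the random PDE on $(-\infty,0]$: for all $s\le t\le0$, $u(t)=e^{A(t-s)+\int_s^tz(\theta_r\omega)dr}u(s)+\int_s^te^{A(t-\sigma)+\int_\sigma^tz(\theta_r\omega)dr}G(\theta_\sigma\omega,u(\sigma))\,d\sigma$. **Invariant manifolds.** A random set is a family $M=\{M(\omega)\}_{\omega\in\Omega}$ of nonempty closed subsets of $H$ such that $\omega\mapsto\inf_{y\in M(\omega)}|x-y|$ is a random variable for every $x\in H$. It is invariant for a random dynamical system $\phi$ if $\phi(t,\omega,M(\omega))\subset M(\theta_t\omega)$ for all $t\ge0$. An invariant random set of the form $M(\omega)=\{\xi+h(\xi,\omega)\,|\,\xi\in H^+\}$ with $h(\cdot,\omega):H^+\to H^-$ Lipschitz is called a Lipschitz unstable manifold. An unstable manifold for the random PDE means one for the random dynamical system $u$. *)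

theory Defs
  imports "HOL-Probability.Probability"
begin

section \<open>Semigroups and exponential dichotomies\<close>

definition strongly_continuous_semigroup ::
    "(real \<Rightarrow> 'a::real_normed_vector \<Rightarrow> 'a) \<Rightarrow> bool" where
  "strongly_continuous_semigroup S \<longleftrightarrow>
     (\<forall>t\<ge>0. bounded_linear (S t)) \<and>
     (\<forall>x. S 0 x = x) \<and>
     (\<forall>s\<ge>0. \<forall>t\<ge>0. \<forall>x. S (s + t) x = S s (S t x)) \<and>
     (\<forall>x. ((\<lambda>t. S t x) \<longlongrightarrow> x) (at_right 0))"

definition generates ::
    "'a::real_normed_vector set \<Rightarrow> ('a \<Rightarrow> 'a) \<Rightarrow> (real \<Rightarrow> 'a \<Rightarrow> 'a) \<Rightarrow> bool" where
  "generates D A S \<longleftrightarrow>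
     strongly_continuous_semigroup S \<and>
     D = {x. \<exists>y. ((\<lambda>h. (1 / h) *\<^sub>R (S h x - x)) \<longlongrightarrow> y) (at_right 0)} \<and>
     (\<forall>x\<in>D. ((\<lambda>h. (1 / h) *\<^sub>R (S h x - x)) \<longlongrightarrow> A x) (at_right 0))"

text \<open>The operator written \<open>e\<^sup>A\<^sup>t\<close> for all real \<open>t\<close> on a subspace \<open>R\<close> on which the
  semigroup is invertible.\<close>

definition extend_backward ::
    "(real \<Rightarrow> 'a \<Rightarrow> 'a) \<Rightarrow> 'a set \<Rightarrow> real \<Rightarrow> 'a \<Rightarrow> 'a" where
  "extend_backward S R t x = (if t \<ge> 0 then S t x else inv_into R (S (- t)) x)"

text \<open>Boundedness of the inverse of \<open>S t\<close> on the range of \<open>P\<close>, implicit in the word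
  isomorphism, is part of the estimate for \<open>t \<le> 0\<close>.\<close>

definition exponential_dichotomy ::
    "(real \<Rightarrow> 'a::real_normed_vector \<Rightarrow> 'a) \<Rightarrow> ('a \<Rightarrow> 'a) \<Rightarrow> real \<Rightarrow> real \<Rightarrow> real \<Rightarrow> bool" where
  "exponential_dichotomy S P \<alpha> \<beta> K \<longleftrightarrow>
     \<alpha> > \<beta> \<and>
     bounded_linear P \<and> (\<forall>x. P (P x) = P x) \<and>
     (\<forall>t\<ge>0. \<forall>x. P (S t x) = S t (P x)) \<and>
     (\<forall>t\<ge>0. bij_betw (S t) (range P) (range P)) \<and>
     (\<forall>t\<le>0. \<forall>x. norm (extend_backward S (range P) t (P x)) \<le> K * exp (\<alpha> * t) * norm x) \<and>
     (\<forall>t\<ge>0. \<forall>x. norm (S t (x - P x)) \<le> K * exp (\<beta> * t) * norm x)"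

section \<open>The noise\<close>

definition C0 :: "(real \<Rightarrow> real) set" where
  "C0 = {\<omega>. continuous_on UNIV \<omega> \<and> \<omega> 0 = 0}"

definition compact_open_topology :: "(real \<Rightarrow> real) topology" where
  "compact_open_topology =
     topology_generated_by {{\<omega> \<in> C0. \<omega> ` C \<subseteq> U} | C U. compact C \<and> open U}"

text \<open>Two-sided Wiener measure on the path space: the paths start at \<open>0\<close> by definition of
  \<open>C0\<close>, and increments over disjoint intervals of the whole real line are
  independent centred Gaussians with variance the length of the interval
  (\<^const>\<open>normal_density\<close> takes the standard deviation).\<close>

definition wiener_measure :: "(real \<Rightarrow> real) measure \<Rightarrow> bool" where
  "wiener_measure W \<longleftrightarrow>
     prob_space W \<and> space W = C0 \<and>
     sets W = sigma_sets C0 {V. openin compact_open_topology V} \<and>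
     (\<forall>s t. s < t \<longrightarrow>
        distributed W lborel (\<lambda>\<omega>. \<omega> t - \<omega> s) (\<lambda>x. ennreal (normal_density 0 (sqrt (t - s)) x))) \<and>
     (\<forall>(\<tau> :: nat \<Rightarrow> real) n. strict_mono_on {..n} \<tau> \<longrightarrow>
        prob_space.indep_vars W (\<lambda>_. borel) (\<lambda>i \<omega>. \<omega> (\<tau> (Suc i)) - \<omega> (\<tau> i)) {..<n})"

definition shift :: "real \<Rightarrow> (real \<Rightarrow> real) \<Rightarrow> real \<Rightarrow> real" where
  "shift t \<omega> = (\<lambda>s. \<omega> (s + t) - \<omega> t)"

definition z_OU :: "(real \<Rightarrow> real) \<Rightarrow> real" where
  "z_OU \<omega> = - (LBINT \<tau>:{..0}. exp \<tau> * \<omega> \<tau>)"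

text \<open>For real arguments, \<^const>\<open>at_infinity\<close> covers both \<open>t \<rightarrow> \<infinity>\<close> and \<open>t \<rightarrow> -\<infinity>\<close>;
  \<open>LBINT \<tau>=a..b\<close> is oriented, as needed for negative \<open>t\<close>.\<close>

definition noise_paths :: "(real \<Rightarrow> real) measure \<Rightarrow> (real \<Rightarrow> real) set \<Rightarrow> bool" where
  "noise_paths W \<Omega> \<longleftrightarrow>
     \<Omega> \<in> sets W \<and> measure W \<Omega> = 1 \<and> (\<forall>t. shift t ` \<Omega> = \<Omega>) \<and>
     (\<forall>\<omega>\<in>\<Omega>.
        ((\<lambda>t. \<omega> t / t) \<longlongrightarrow> 0) at_infinity \<and>
        set_integrable lborel {..0} (\<lambda>\<tau>. exp \<tau> * \<omega> \<tau>) \<and>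
        continuous_on UNIV (\<lambda>t. z_OU (shift t \<omega>)) \<and>
        ((\<lambda>t. \<bar>z_OU (shift t \<omega>)\<bar> / \<bar>t\<bar>) \<longlongrightarrow> 0) at_infinity \<and>
        ((\<lambda>t. (1 / t) * (LBINT \<tau>=0..t. z_OU (shift \<tau> \<omega>))) \<longlongrightarrow> 0) at_infinity)"

section \<open>The random equation and its mild solutions\<close>

definition G_rand :: "('a::real_normed_vector \<Rightarrow> 'a) \<Rightarrow> (real \<Rightarrow> real) \<Rightarrow> 'a \<Rightarrow> 'a" where
  "G_rand F \<omega> x = exp (- z_OU \<omega>) *\<^sub>R F (exp (z_OU \<omega>) *\<^sub>R x)"

text \<open>\<open>G\<close> inherits the Lipschitz constant of \<open>F\<close>.  Take \<open>Q = P\<^sup>+\<close> or \<open>Q = P\<^sup>-\<close>.\<close>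

lemma G_rand_Lipschitz:
  assumes "linear Q" and "\<And>x1 x2. norm (Q (F x1 - F x2)) \<le> L * norm (x1 - x2)"
  shows "norm (Q (G_rand F \<omega> x1 - G_rand F \<omega> x2)) \<le> L * norm (x1 - x2)"
proof -
  let ?e = "exp (z_OU \<omega>)"
  have "G_rand F \<omega> x1 - G_rand F \<omega> x2 =
      exp (- z_OU \<omega>) *\<^sub>R (F (?e *\<^sub>R x1) - F (?e *\<^sub>R x2))"
    by (simp add: G_rand_def scaleR_diff_right)
  then have "norm (Q (G_rand F \<omega> x1 - G_rand F \<omega> x2)) =
      exp (- z_OU \<omega>) * norm (Q (F (?e *\<^sub>R x1) - F (?e *\<^sub>R x2)))"
    using assms(1) by (simp add: linear_scale)
  also have "\<dots> \<le> exp (- z_OU \<omega>) * (L * norm (?e *\<^sub>R x1 - ?e *\<^sub>R x2))"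
    by (intro mult_left_mono assms(2)) simp
  also have "\<dots> = L * norm (x1 - x2)"
    by (simp add: scaleR_diff_right [symmetric] exp_minus)
  finally show ?thesis .
qed

text \<open>The operator \<open>e\<close> to the power \<open>A(t - s) + \<integral>\<^sub>s\<^sup>t z(\<theta>\<^sub>r\<omega>) dr\<close>, for \<open>s \<le> t\<close>.\<close>

definition evol ::
    "(real \<Rightarrow> 'a::real_normed_vector \<Rightarrow> 'a) \<Rightarrow> (real \<Rightarrow> real) \<Rightarrow> real \<Rightarrow> real \<Rightarrow> 'a \<Rightarrow> 'a" where
  "evol S \<omega> s t x = exp (LBINT r=s..t. z_OU (shift r \<omega>)) *\<^sub>R S (t - s) x"

definition forward_mild_solution ::
    "(real \<Rightarrow> 'a::{banach, second_countable_topology} \<Rightarrow> 'a) \<Rightarrow> ('a \<Rightarrow> 'a) \<Rightarrow>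
     (real \<Rightarrow> real) \<Rightarrow> 'a \<Rightarrow> (real \<Rightarrow> 'a) \<Rightarrow> bool" where
  "forward_mild_solution S F \<omega> u0 v \<longleftrightarrow>
     continuous_on {0..} v \<and>
     (\<forall>t\<ge>0. v t = evol S \<omega> 0 t u0 +
        (LBINT s=0..t. evol S \<omega> s t (G_rand F (shift s \<omega>) (v s))))"

definition backward_mild_solution ::
    "(real \<Rightarrow> 'a::{banach, second_countable_topology} \<Rightarrow> 'a) \<Rightarrow> ('a \<Rightarrow> 'a) \<Rightarrow>
     (real \<Rightarrow> real) \<Rightarrow> (real \<Rightarrow> 'a) \<Rightarrow> bool" where
  "backward_mild_solution S F \<omega> v \<longleftrightarrow>
     (\<forall>t\<le>0. \<forall>s\<le>t. v t = evol S \<omega> s t (v s) +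
        (LBINT \<sigma>=s..t. evol S \<omega> \<sigma> t (G_rand F (shift \<sigma> \<omega>) (v \<sigma>))))"

text \<open>Functions on \<open>(-\<infinity>, 0]\<close> are represented by total functions; values at positive
  times are irrelevant.\<close>

definition C_minus :: "real \<Rightarrow> (real \<Rightarrow> real) \<Rightarrow> (real \<Rightarrow> 'a::real_normed_vector) set" where
  "C_minus \<eta> \<omega> =
     {\<phi>. continuous_on {..0} \<phi> \<and>
         bdd_above ((\<lambda>t. exp (- \<eta> * t - (LBINT \<tau>=0..t. z_OU (shift \<tau> \<omega>))) * norm (\<phi> t)) ` {..0})}"

definition M_u ::
    "(real \<Rightarrow> 'a::{banach, second_countable_topology} \<Rightarrow> 'a) \<Rightarrow> ('a \<Rightarrow> 'a) \<Rightarrow> real \<Rightarrow>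
     (real \<Rightarrow> real) \<Rightarrow> 'a set" where
  "M_u S F \<eta> \<omega> = {u0. \<exists>v \<in> C_minus \<eta> \<omega>. v 0 = u0 \<and> backward_mild_solution S F \<omega> v}"

section \<open>Random dynamical systems and invariant manifolds\<close>

text \<open>In this section \<open>N\<close> is the probability space of paths, \<open>\<Omega>\<close> with the trace
  \<open>\<sigma>\<close>-algebra.\<close>

definition random_dynamical_system ::
    "(real \<Rightarrow> real) measure \<Rightarrow> (real \<Rightarrow> (real \<Rightarrow> real) \<Rightarrow> 'a::topological_space \<Rightarrow> 'a) \<Rightarrow> bool" where
  "random_dynamical_system N \<phi> \<longleftrightarrow>
     (\<lambda>(t, \<omega>, x). \<phi> t \<omega> x) \<in>
        restrict_space borel {0..} \<Otimes>\<^sub>M (N \<Otimes>\<^sub>M borel) \<rightarrow>\<^sub>M borel \<and>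
     (\<forall>\<omega>\<in>space N. \<forall>x. \<phi> 0 \<omega> x = x) \<and>
     (\<forall>\<omega>\<in>space N. \<forall>t1\<ge>0. \<forall>t2\<ge>0. \<forall>x.
        \<phi> (t1 + t2) \<omega> x = \<phi> t2 (shift t1 \<omega>) (\<phi> t1 \<omega> x))"

definition random_set ::
    "(real \<Rightarrow> real) measure \<Rightarrow> ((real \<Rightarrow> real) \<Rightarrow> 'a::metric_space set) \<Rightarrow> bool" where
  "random_set N M \<longleftrightarrow>
     (\<forall>\<omega>\<in>space N. M \<omega> \<noteq> {} \<and> closed (M \<omega>)) \<and>
     (\<forall>x. (\<lambda>\<omega>. infdist x (M \<omega>)) \<in> borel_measurable N)"

definition invariant_random_set ::
    "(real \<Rightarrow> real) measure \<Rightarrow> (real \<Rightarrow> (real \<Rightarrow> real) \<Rightarrow> 'a::metric_space \<Rightarrow> 'a) \<Rightarrow>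
     ((real \<Rightarrow> real) \<Rightarrow> 'a set) \<Rightarrow> bool" where
  "invariant_random_set N \<phi> M \<longleftrightarrow>
     random_set N M \<and>
     (\<forall>\<omega>\<in>space N. \<forall>t\<ge>0. \<phi> t \<omega> ` M \<omega> \<subseteq> M (shift t \<omega>))"

definition lipschitz_graph ::
    "'a::real_normed_vector set \<Rightarrow> 'a set \<Rightarrow> ('a \<Rightarrow> 'a) \<Rightarrow> 'a set \<Rightarrow> bool" where
  "lipschitz_graph Hp Hm h M \<longleftrightarrow>
     h ` Hp \<subseteq> Hm \<and> (\<exists>L. L-lipschitz_on Hp h) \<and> M = {\<xi> + h \<xi> | \<xi>. \<xi> \<in> Hp}"

definition lipschitz_unstable_manifold ::
    "(real \<Rightarrow> real) measure \<Rightarrow> 'a::real_normed_vector set \<Rightarrow> 'a set \<Rightarrow>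
     (real \<Rightarrow> (real \<Rightarrow> real) \<Rightarrow> 'a \<Rightarrow> 'a) \<Rightarrow> ((real \<Rightarrow> real) \<Rightarrow> 'a set) \<Rightarrow> bool" where
  "lipschitz_unstable_manifold N Hp Hm \<phi> M \<longleftrightarrow>
     invariant_random_set N \<phi> M \<and>
     (\<exists>h. \<forall>\<omega>\<in>space N. lipschitz_graph Hp Hm (\<lambda>\<xi>. h \<xi> \<omega>) (M \<omega>))"

section \<open>Conjugation with the stochastic equation\<close>

definition T_map :: "(real \<Rightarrow> real) \<Rightarrow> 'a::real_vector \<Rightarrow> 'a" where
  "T_map \<omega> x = exp (- z_OU \<omega>) *\<^sub>R x"

definition T_inv :: "(real \<Rightarrow> real) \<Rightarrow> 'a::real_vector \<Rightarrow> 'a" where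
  "T_inv \<omega> x = exp (z_OU \<omega>) *\<^sub>R x"

text \<open>The random dynamical system generated by \<open>du = A u dt + F(u) dt + u/2 dt + u dW\<close>,
  obtained from the one of the random equation.\<close>

definition u_hat ::
    "(real \<Rightarrow> (real \<Rightarrow> real) \<Rightarrow> 'a \<Rightarrow> 'a) \<Rightarrow> real \<Rightarrow> (real \<Rightarrow> real) \<Rightarrow> 'a::real_vector \<Rightarrow> 'a" where
  "u_hat u t \<omega> x = T_inv (shift t \<omega>) (u t \<omega> (T_map \<omega> x))"

end

theory Submission imports Defs begin

text \<open>
  The proof is the Lyapunov--Perron method, after a change of variables that removes the noise from
  the linear part. Write a solution of the random equation as
  \<open>v t = exp (\<integral>\<^sub>0\<^sup>t z(\<theta>\<^sub>r \<omega>) dr + \<eta> t) y t\<close>. Then \<open>v\<close> lies in the weighted space \<open>C\<^sub>\<eta>\<^sup>-\<close> exactly when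
  \<open>y\<close> is continuous and bounded on the negative half line, and \<open>v\<close> is a mild solution exactly
  when \<open>y\<close> is a mild solution of a deterministic nonautonomous equation
  (\<open>mild_solution_rescale\<close>, \<open>M_u_eq_bounded_backward_orbits\<close>). Its linear part is the semigroup
  \<open>exp (- \<eta> t) S t\<close>, whose dichotomy exponents \<open>\<alpha> - \<eta>\<close> and \<open>\<beta> - \<eta>\<close> have opposite signs; its
  nonlinearity is \<open>y \<mapsto> exp (- c) F (exp c y)\<close> with a continuous function \<open>c\<close> of time and therefore
  has the Lipschitz constant of \<open>F\<close> and vanishes at the origin.

  For a bounded continuous right-hand side \<open>f\<close>, a bounded function \<open>y\<close> on the negative half line is
  a mild solution if and only if it is given by the variation of constants formula with the Green
  kernel of the dichotomy and the unstable datum \<open>P (y 0)\<close>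
  (\<open>bounded_mild_imp_Green\<close>, \<open>Green_imp_mild\<close>): the unstable part is integrated backwards from time
  \<open>0\<close>, the stable part forwards from \<open>-\<infinity>\<close>, where boundedness makes the initial term disappear.
  Inserting \<open>f \<sigma> = g \<sigma> (y \<sigma>)\<close> gives a fixed point equation depending on a parameter \<open>\<xi> \<in> range P\<close>. The
  integral of the kernel is at most \<open>K (1 / (\<eta> - \<beta>) + 1 / (\<alpha> - \<eta>))\<close>, so that the gap condition makes
  the fixed point operator a contraction for the supremum norm. The set of all \<open>y 0\<close> is thus the graph
  of \<open>\<xi> \<mapsto> y 0 - \<xi>\<close>, a Lipschitz map into the stable subspace
  (\<open>lipschitz_graph_bounded_backward_orbits\<close>).

  The graph depends measurably on \<open>\<omega>\<close> because the fixed point is the limit of Picard iterates, which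
  are jointly measurable in time and path (\<open>measurable_graph_map\<close>); a countable dense set of points
  of the graph then makes the distance to it a countable infimum of random variables
  (\<open>random_set_Castaing\<close>). Invariance is concatenation: the forward solution from a point of
  \<open>M\<^sup>u(\<omega>)\<close> continues the bounded backward solution through it, and shifting time by \<open>t\<close> turns the
  result into a bounded backward solution for \<open>\<theta>\<^sub>t \<omega>\<close> (\<open>M_u_invariant\<close>). Finally \<open>T\<^sup>-\<^sup>1(\<omega>, \<sqdot>)\<close> is a
  homothety by a positive measurable factor that conjugates the two random dynamical systems.
\<close>

section \<open>Measurable families and random sets\<close>

text \<open>
  The function is the pointwise limit of functions that see only the countably many times
  \<open>\<lfloor>(k + 1) t\<rfloor> / (k + 1)\<close>, and these are measurable piece by piece.
\<close>

lemma measurable_Caratheodory: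
  fixes f :: "real \<Rightarrow> 'b \<Rightarrow> 'c::metric_space"
  assumes meas: "\<And>t. f t \<in> borel_measurable N"
    and cont: "\<And>\<omega>. \<omega> \<in> space N \<Longrightarrow> continuous_on UNIV (\<lambda>t. f t \<omega>)"
  shows "(\<lambda>p. f (fst p) (snd p)) \<in> borel_measurable (borel \<Otimes>\<^sub>M N)"
proof (rule borel_measurable_LIMSEQ_metric)
  fix k :: nat
  have "(\<lambda>p. f (real_of_int i / real (Suc k)) (snd p)) \<in> borel_measurable (borel \<Otimes>\<^sub>M N)" for i :: int
    using meas by measurable
  moreover have "(\<lambda>p. \<lfloor>real (Suc k) * fst p\<rfloor>) \<in> borel \<Otimes>\<^sub>M N \<rightarrow>\<^sub>M count_space UNIV"
    by measurable
  ultimately show "(\<lambda>p. f (real_of_int \<lfloor>real (Suc k) * fst p\<rfloor> / real (Suc k)) (snd p))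
      \<in> borel_measurable (borel \<Otimes>\<^sub>M N)"
    by (rule measurable_compose_countable)
next
  fix p assume p: "p \<in> space (borel \<Otimes>\<^sub>M N :: (real \<times> 'b) measure)"
  let ?t = "fst p"
  have bound: "\<bar>real_of_int \<lfloor>real (Suc k) * ?t\<rfloor> / real (Suc k) - ?t\<bar> \<le> 1 / real (Suc k)" for k
  proof -
    have "real_of_int \<lfloor>real (Suc k) * ?t\<rfloor> / real (Suc k) - ?t =
        (real_of_int \<lfloor>real (Suc k) * ?t\<rfloor> - real (Suc k) * ?t) / real (Suc k)"
      by (simp add: divide_simps)
    moreover have "\<bar>real_of_int \<lfloor>real (Suc k) * ?t\<rfloor> - real (Suc k) * ?t\<bar> \<le> 1"
      by linarith
    ultimately show ?thesis
      by (simp add: divide_right_mono)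
  qed
  have "(\<lambda>k. real_of_int \<lfloor>real (Suc k) * ?t\<rfloor> / real (Suc k) - ?t) \<longlonglongrightarrow> 0"
    by (rule Lim_null_comparison[OF _ lim_inverse_n'[THEN LIMSEQ_Suc]]) (use bound in simp)
  then have "(\<lambda>k. real_of_int \<lfloor>real (Suc k) * ?t\<rfloor> / real (Suc k)) \<longlonglongrightarrow> ?t"
    by (simp add: LIM_zero_iff)
  moreover have "snd p \<in> space N"
    using p by (auto simp: space_pair_measure)
  ultimately show "(\<lambda>k. f (real_of_int \<lfloor>real (Suc k) * ?t\<rfloor> / real (Suc k)) (snd p)) \<longlonglongrightarrow> f (fst p) (snd p)"
    using continuous_on_tendsto_compose[OF cont, of "snd p" _ ?t] by simp
qed

text \<open>A countable dense family of measurable selections (a Castaing representation) turns the distance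
  function into a countable infimum.\<close>
lemma random_set_Castaing:
  fixes M :: "(real \<Rightarrow> real) \<Rightarrow> 'a::{real_normed_vector, second_countable_topology} set"
  assumes D: "countable D" "D \<noteq> {}"
    and meas: "\<And>d. d \<in> D \<Longrightarrow> s d \<in> borel_measurable N"
    and dense: "\<And>\<omega>. \<omega> \<in> space N \<Longrightarrow> M \<omega> = closure ((\<lambda>d. s d \<omega>) ` D)"
  shows "random_set N M"
proof -
  have "(\<lambda>\<omega>. infdist x (M \<omega>)) \<in> borel_measurable N" for x
  proof (subst measurable_cong)
    fix \<omega> assume "\<omega> \<in> space N"
    then have "infdist x (M \<omega>) = infdist x ((\<lambda>d. s d \<omega>) ` D)"
      by (simp add: dense infdist_eq_setdist)
    also have "\<dots> = (INF d\<in>D. dist x (s d \<omega>))"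
      using D by (simp add: infdist_def image_image)
    finally show "infdist x (M \<omega>) = (INF d\<in>D. dist x (s d \<omega>))" .
  next
    show "(\<lambda>\<omega>. INF d\<in>D. dist x (s d \<omega>)) \<in> borel_measurable N"
      using D meas by (intro borel_measurable_cINF_real borel_measurable_dist) auto
  qed
  then show ?thesis
    using D by (auto simp: random_set_def dense)
qed

section \<open>Integrals of continuous functions over intervals\<close>

lemma interval_integral_combine:
  fixes f :: "real \<Rightarrow> 'b::{banach, second_countable_topology}"
  assumes "a \<le> b" "b \<le> c" "continuous_on {a..c} f"
  shows "(LBINT x=a..b. f x) + (LBINT x=b..c. f x) = (LBINT x=a..c. f x)"
  using assms by (intro interval_integral_sum) (auto simp: min_def max_def intro!: interval_integrable_continuous_on)

lemma interval_integral_bounded_linear: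
  fixes f :: "real \<Rightarrow> 'b::{banach, second_countable_topology}"
    and T :: "'b \<Rightarrow> 'c::{banach, second_countable_topology}"
  assumes "bounded_linear T" "a \<le> b" "continuous_on {a..b} f"
  shows "(LBINT x=a..b. T (f x)) = T (LBINT x=a..b. f x)"
proof -
  have "integrable lborel (\<lambda>x. indicator {a..b} x *\<^sub>R f x)"
    using borel_integrable_atLeastAtMost'[OF assms(3)] by (simp add: set_integrable_def)
  from integral_bounded_linear[OF assms(1) this] show ?thesis
    using assms(2) linear_simps(5)[OF assms(1)]
    by (simp add: interval_integral_Icc set_lebesgue_integral_def)
qed

lemma continuous_on_integral_from_0:
  fixes f :: "real \<Rightarrow> real"
  assumes f: "continuous_on UNIV f"
  shows "continuous_on UNIV (\<lambda>t::real. LBINT r=0..t. f r)"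
proof -
  have "isCont (\<lambda>t::real. LBINT r=0..t. f r) t" for t :: real
  proof -
    let ?a = "- \<bar>t\<bar> - 1" and ?b = "\<bar>t\<bar> + 1"
    have "((\<lambda>u. LBINT y=ereal 0..ereal u. f y) has_vector_derivative f t) (at t within {?a..?b})"
      by (rule interval_integral_FTC2) (auto intro: continuous_on_subset[OF f])
    then have "continuous (at t within {?a..?b}) (\<lambda>u. LBINT y=ereal 0..ereal u. f y)"
      by (rule has_vector_derivative_continuous)
    moreover have "t \<in> interior {?a..?b}"
      by auto
    ultimately show ?thesis
      by (metis at_within_interior zero_ereal_def)
  qed
  then show ?thesis
    by (simp add: continuous_at_imp_continuous_on)
qed

lemma integral_from_0_diff:
  fixes f :: "real \<Rightarrow> real" and s t :: real
  assumes f: "continuous_on UNIV f"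
  shows "(LBINT r=s..t. f r) = (LBINT r=0..t. f r) - (LBINT r=0..s. f r)"
proof -
  have "(LBINT r=ereal 0..ereal s. f r) + (LBINT r=ereal s..ereal t. f r) = (LBINT r=ereal 0..ereal t. f r)"
    by (rule interval_integral_sum)
      (auto simp: min_def max_def intro!: interval_integrable_continuous_on continuous_on_subset[OF f])
  then show ?thesis
    by (simp add: zero_ereal_def)
qed

lemma interval_integral_shift:
  fixes f :: "real \<Rightarrow> 'b::{banach, second_countable_topology}" and a b d :: real
  assumes "a \<le> b"
  shows "(LBINT x=a..b. f (x + d)) = (LBINT x=a + d..b + d. f x)"
proof -
  have "(LBINT x=a + d..b + d. f x) = (\<integral>x. indicator {a + d..b + d} x *\<^sub>R f x \<partial>lborel)"
    using assms interval_integral_Icc[of "a + d" "b + d" f] by (simp add: set_lebesgue_integral_def)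
  also have "\<dots> = (\<integral>x. indicator {a + d..b + d} (d + 1 * x) *\<^sub>R f (d + 1 * x) \<partial>lborel)"
    by (subst lborel_integral_real_affine[of 1 _ d]) auto
  also have "\<dots> = (\<integral>x. indicator {a..b} x *\<^sub>R f (x + d) \<partial>lborel)"
    by (intro Bochner_Integration.integral_cong) (auto simp: indicator_def add.commute)
  also have "\<dots> = (LBINT x=a..b. f (x + d))"
    using assms by (simp add: interval_integral_Icc set_lebesgue_integral_def)
  finally show ?thesis ..
qed

lemma interval_integral_scaleR:
  fixes f :: "real \<Rightarrow> 'b::{banach, second_countable_topology}"
  shows "(LBINT x=a..b. c *\<^sub>R f x) = c *\<^sub>R (LBINT x=a..b. f x)"
  by (simp add: interval_lebesgue_integral_def)

section \<open>Semigroups with an exponential dichotomy\<close>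

lemma strongly_continuous_semigroup_rescale:
  assumes "strongly_continuous_semigroup S"
  shows "strongly_continuous_semigroup (\<lambda>t x. exp (- \<eta> * t) *\<^sub>R S t x)"
  unfolding strongly_continuous_semigroup_def
proof (intro conjI allI impI)
  note S = assms[unfolded strongly_continuous_semigroup_def]
  fix s t :: real and x
  show "bounded_linear (\<lambda>x. exp (- \<eta> * t) *\<^sub>R S t x)" if "t \<ge> 0"
    using S that by (intro bounded_linear_const_scaleR) auto
  show "exp (- \<eta> * 0) *\<^sub>R S 0 x = x"
    using S by simp
  show "exp (- \<eta> * (s + t)) *\<^sub>R S (s + t) x = exp (- \<eta> * s) *\<^sub>R S s (exp (- \<eta> * t) *\<^sub>R S t x)"
    if "s \<ge> 0" "t \<ge> 0"
  proof -
    have "bounded_linear (S s)"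
      using S that by simp
    then show ?thesis
      using S that by (simp add: linear_simps exp_add[symmetric] algebra_simps)
  qed
  have "((\<lambda>t. exp (- \<eta> * t) *\<^sub>R S t x) \<longlongrightarrow> exp (- \<eta> * 0) *\<^sub>R x) (at_right 0)"
    using S by (intro tendsto_intros) auto
  then show "((\<lambda>t. exp (- \<eta> * t) *\<^sub>R S t x) \<longlongrightarrow> x) (at_right 0)"
    by simp
qed

text \<open>Multiplying the semigroup by \<open>exp (- \<eta> t)\<close> shifts both exponents by \<open>\<eta>\<close>. For \<open>\<beta> < \<eta> < \<alpha>\<close> this moves
  the gap of the dichotomy to the origin, so that weighted estimates become uniform ones.\<close>
lemma exponential_dichotomy_rescale:
  fixes S :: "real \<Rightarrow> 'a::real_normed_vector \<Rightarrow> 'a"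
  assumes dich: "exponential_dichotomy S P \<alpha> \<beta> K"
    and sg: "strongly_continuous_semigroup S"
  shows "exponential_dichotomy (\<lambda>t x. exp (- \<eta> * t) *\<^sub>R S t x) P (\<alpha> - \<eta>) (\<beta> - \<eta>) K"
proof -
  let ?S = "\<lambda>t x. exp (- \<eta> * t) *\<^sub>R S t x"
  note d = dich[unfolded exponential_dichotomy_def]
  note s = sg[unfolded strongly_continuous_semigroup_def]
  have P: "bounded_linear P"
    using d by blast
  have lin: "bounded_linear (S t)" if "t \<ge> 0" for t
    using s that by blast
  have range_scale: "c *\<^sub>R y \<in> range P" if "y \<in> range P" for c :: real and y
    using that linear_simps(5)[OF P] by (metis rangeE rangeI)
  have bij: "bij_betw (?S t) (range P) (range P)" if t: "t \<ge> 0" for t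
  proof -
    have b: "bij_betw (S t) (range P) (range P)"
      using d t by auto
    have "bij_betw (\<lambda>y. exp (- \<eta> * t) *\<^sub>R y) (range P) (range P)"
      by (rule bij_betw_byWitness[where f' = "\<lambda>y. exp (\<eta> * t) *\<^sub>R y"])
        (auto simp: exp_add[symmetric] range_scale)
    from bij_betw_trans[OF b this] show ?thesis
      by (simp add: o_def)
  qed
  have ext: "extend_backward ?S (range P) t (P x) = exp (- \<eta> * t) *\<^sub>R extend_backward S (range P) t (P x)"
    for t x
  proof (cases "t \<ge> 0")
    case False
    then have t: "- t \<ge> 0" by simp
    have b: "bij_betw (S (- t)) (range P) (range P)"
      using d t by blast
    let ?r = "inv_into (range P) (S (- t)) (P x)"
    have r: "?r \<in> range P" "S (- t) ?r = P x"
      using b by (auto simp: bij_betw_def f_inv_into_f intro: inv_into_into)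
    have "inv_into (range P) (?S (- t)) (P x) = exp (- \<eta> * t) *\<^sub>R ?r"
    proof (rule inv_into_f_eq)
      show "inj_on (?S (- t)) (range P)"
        using bij[OF t] by (simp add: bij_betw_def)
      show "exp (- \<eta> * t) *\<^sub>R ?r \<in> range P"
        using r range_scale by blast
      show "?S (- t) (exp (- \<eta> * t) *\<^sub>R ?r) = P x"
        using r(2) linear_simps(5)[OF lin[OF t]] by (simp add: exp_add[symmetric])
    qed
    then show ?thesis
      using False by (simp add: extend_backward_def)
  qed (simp add: extend_backward_def)
  have scale: "exp (- \<eta> * t) * (K * exp (c * t) * n) = K * exp ((c - \<eta>) * t) * n" for t c n
    by (simp add: exp_add[symmetric] algebra_simps)
  show ?thesis
    unfolding exponential_dichotomy_def
  proof (intro conjI allI impI)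
    fix t :: real and x :: 'a
    show "P (?S t x) = ?S t (P x)" if "t \<ge> 0"
      using d that linear_simps(5)[OF P] by simp
    show "norm (extend_backward ?S (range P) t (P x)) \<le> K * exp ((\<alpha> - \<eta>) * t) * norm x" if "t \<le> 0"
    proof -
      have "norm (extend_backward S (range P) t (P x)) \<le> K * exp (\<alpha> * t) * norm x"
        using d that by blast
      then show ?thesis
        unfolding ext scale[symmetric] by simp
    qed
    show "norm (?S t (x - P x)) \<le> K * exp ((\<beta> - \<eta>) * t) * norm x" if "t \<ge> 0"
    proof -
      have "norm (S t (x - P x)) \<le> K * exp (\<beta> * t) * norm x"
        using d that by blast
      then show ?thesis
        unfolding scale[symmetric] by simp
    qed
  qed (use d bij in auto)
qed

text \<open>Semigroup increments are controlled from the left end point by a modulus that depends on the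
  length of the time step only; right continuity at \<open>0\<close> then gives two-sided continuity.\<close>
lemma continuous_on_modulus:
  fixes f :: "real \<Rightarrow> 'a::real_normed_vector"
  assumes step: "\<And>s t. s \<le> t \<Longrightarrow> s \<in> T \<Longrightarrow> t \<in> T \<Longrightarrow> norm (f t - f s) \<le> m (t - s)"
    and m: "(m \<longlongrightarrow> 0) (at_right 0)"
  shows "continuous_on T f"
  unfolding continuous_on_iff
proof (intro ballI allI impI)
  fix t e :: real assume t: "t \<in> T" and e: "0 < e"
  from order_tendstoD(2)[OF m e] obtain d where d: "d > 0" "\<And>h. 0 < h \<Longrightarrow> h < d \<Longrightarrow> m h < e"
    by (auto simp: eventually_at_right_field)
  have "dist (f s) (f t) < e" if s: "s \<in> T" "dist s t < d" for s
  proof (cases s t rule: linorder_cases)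
    case less
    then have "norm (f t - f s) \<le> m (t - s)" "m (t - s) < e"
      using step[of s t] d(2)[of "t - s"] s t by (auto simp: dist_real_def)
    then show ?thesis by (simp add: dist_norm norm_minus_commute)
  next
    case greater
    then have "norm (f s - f t) \<le> m (s - t)" "m (s - t) < e"
      using step[of t s] d(2)[of "s - t"] s t by (auto simp: dist_real_def)
    then show ?thesis by (simp add: dist_norm)
  qed (use e in auto)
  then show "\<exists>d>0. \<forall>s\<in>T. dist s t < d \<longrightarrow> dist (f s) (f t) < e"
    using d(1) by blast
qed

text \<open>Strong continuity and a uniform bound on the operators give joint continuity.\<close>
lemma continuous_on_strong_joint:
  fixes T :: "real \<Rightarrow> 'a::real_normed_vector \<Rightarrow> 'b::real_normed_vector"
  assumes diff: "\<And>t x y. t \<in> I \<Longrightarrow> norm (T t x - T t y) \<le> C * norm (x - y)"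
    and strong: "\<And>x. continuous_on I (\<lambda>t. T t x)"
  shows "continuous_on (I \<times> UNIV) (\<lambda>p. T (fst p) (snd p))"
  unfolding continuous_on_def
proof (intro ballI)
  fix p :: "real \<times> 'a" assume p: "p \<in> I \<times> UNIV"
  let ?F = "at p within I \<times> UNIV"
  let ?b = "\<lambda>q. C * norm (snd q - snd p) + norm (T (fst q) (snd p) - T (fst p) (snd p))"
  have "continuous_on (I \<times> UNIV) ?b"
    by (intro continuous_intros continuous_on_compose2[OF strong]) auto
  then have "(?b \<longlongrightarrow> ?b p) ?F"
    using p by (auto simp only: continuous_on_def)
  then have b: "(?b \<longlongrightarrow> 0) ?F"
    by simp
  have "norm (T (fst q) (snd q) - T (fst p) (snd p)) \<le> ?b q" if "q \<in> I \<times> UNIV" for q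
  proof -
    have "norm (T (fst q) (snd q) - T (fst p) (snd p)) \<le>
        norm (T (fst q) (snd q) - T (fst q) (snd p)) + norm (T (fst q) (snd p) - T (fst p) (snd p))"
      using norm_triangle_ineq[of "T (fst q) (snd q) - T (fst q) (snd p)"
          "T (fst q) (snd p) - T (fst p) (snd p)"] by simp
    moreover have "norm (T (fst q) (snd q) - T (fst q) (snd p)) \<le> C * norm (snd q - snd p)"
      using that by (intro diff) auto
    ultimately show ?thesis
      by simp
  qed
  then have "\<forall>\<^sub>F q in ?F. norm (T (fst q) (snd q) - T (fst p) (snd p)) \<le> ?b q"
    by (auto simp: eventually_at_filter)
  from Lim_null_comparison[OF this b] show "((\<lambda>q. T (fst q) (snd q)) \<longlongrightarrow> T (fst p) (snd p)) ?F"
    by (rule LIM_zero_cancel)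
qed

locale dichotomy =
  fixes S :: "real \<Rightarrow> 'a::{banach, second_countable_topology} \<Rightarrow> 'a"
    and P :: "'a \<Rightarrow> 'a" and \<alpha> \<beta> K :: real
  assumes sg: "strongly_continuous_semigroup S"
    and dich: "exponential_dichotomy S P \<alpha> \<beta> K"
    and K_nonneg: "0 \<le> K"
    and signs: "\<beta> < 0" "0 < \<alpha>"
begin

lemma lin_S: "t \<ge> 0 \<Longrightarrow> bounded_linear (S t)"
  and S_0 [simp]: "S 0 x = x"
  and S_add: "s \<ge> 0 \<Longrightarrow> t \<ge> 0 \<Longrightarrow> S (s + t) x = S s (S t x)"
  and S_right: "((\<lambda>t. S t x) \<longlongrightarrow> x) (at_right 0)"
  using sg by (auto simp: strongly_continuous_semigroup_def)

lemma lin_P: "bounded_linear P"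
  and P_P [simp]: "P (P x) = P x"
  and P_S: "t \<ge> 0 \<Longrightarrow> P (S t x) = S t (P x)"
  and bij_S: "t \<ge> 0 \<Longrightarrow> bij_betw (S t) (range P) (range P)"
  and bound_plus: "t \<le> 0 \<Longrightarrow> norm (extend_backward S (range P) t (P x)) \<le> K * exp (\<alpha> * t) * norm x"
  and bound_minus: "t \<ge> 0 \<Longrightarrow> norm (S t (x - P x)) \<le> K * exp (\<beta> * t) * norm x"
  using dich by (auto simp: exponential_dichotomy_def)

lemmas P_simps [simp] = linear_simps[OF lin_P]

lemma in_range_P: "y \<in> range P \<longleftrightarrow> P y = y"
  by (metis P_P rangeE rangeI)

text \<open>The two parts of \<open>e\<^sup>A\<^sup>t\<close> are \<open>e\<^sup>A\<^sup>t P\<^sup>+\<close>, defined for all real \<open>t\<close>, and \<open>e\<^sup>A\<^sup>t P\<^sup>-\<close>, meaningful for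
  \<open>t \<ge> 0\<close> only.\<close>
definition Ep :: "real \<Rightarrow> 'a \<Rightarrow> 'a" where
  "Ep t x = extend_backward S (range P) t (P x)"

definition Em :: "real \<Rightarrow> 'a \<Rightarrow> 'a" where
  "Em t x = S t (x - P x)"

lemma P_Ep [simp]: "P (Ep t x) = Ep t x"
proof (cases "t \<ge> 0")
  case True
  then show ?thesis by (simp add: Ep_def extend_backward_def P_S)
next
  case False
  then have "P x \<in> S (- t) ` range P"
    using bij_S[of "- t"] by (auto simp: bij_betw_def)
  then have "inv_into (range P) (S (- t)) (P x) \<in> range P"
    by (rule inv_into_into)
  then show ?thesis
    using False by (simp add: Ep_def extend_backward_def in_range_P)
qed

lemma Ep_P [simp]: "Ep t (P x) = Ep t x"
  by (simp add: Ep_def)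

lemma Ep_forward: "t \<ge> 0 \<Longrightarrow> Ep t x = S t (P x)"
  by (simp add: Ep_def extend_backward_def)

lemma S_Ep: "n \<ge> 0 \<Longrightarrow> n + t \<ge> 0 \<Longrightarrow> S n (Ep t x) = S (n + t) (P x)"
proof (cases "t \<ge> 0")
  case False
  assume n: "n \<ge> 0" "n + t \<ge> 0"
  have "P x \<in> S (- t) ` range P"
    using bij_S[of "- t"] False by (auto simp: bij_betw_def)
  then have "S (- t) (Ep t x) = P x"
    using False by (simp add: Ep_def extend_backward_def f_inv_into_f)
  then show ?thesis
    using S_add[of "n + t" "- t"] n False by simp
qed (simp add: Ep_forward S_add)

text \<open>For \<open>n\<close> so large that \<open>n + t \<ge> 0\<close>, \<open>Ep t x\<close> is the only point of the unstable subspace that \<open>S n\<close> maps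
  to \<open>S (n + t) (P x)\<close>. The group law and linearity at negative times follow from this without
  distinguishing signs.\<close>
lemma Ep_eqI:
  assumes "n \<ge> 0" "n + t \<ge> 0" "P r = r" "S n r = S (n + t) (P x)"
  shows "Ep t x = r"
proof -
  have "inj_on (S n) (range P)"
    using bij_S[OF assms(1)] by (simp add: bij_betw_def)
  moreover have "S n (Ep t x) = S n r"
    using S_Ep assms by simp
  ultimately show ?thesis
    by (rule inj_onD) (simp_all add: assms in_range_P)
qed

lemma Ep_add: "Ep (s + t) x = Ep s (Ep t x)"
proof (rule Ep_eqI[where n = "\<bar>s\<bar> + \<bar>t\<bar>"])
  have "S (\<bar>s\<bar> + \<bar>t\<bar>) (Ep s (Ep t x)) = S (\<bar>s\<bar> + \<bar>t\<bar> + s) (Ep t x)"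
    using S_Ep[of "\<bar>s\<bar> + \<bar>t\<bar>" s "Ep t x"] by simp
  also have "\<dots> = S (\<bar>s\<bar> + \<bar>t\<bar> + (s + t)) (P x)"
    using S_Ep[of "\<bar>s\<bar> + \<bar>t\<bar> + s" t x] by (simp add: add.assoc)
  finally show "S (\<bar>s\<bar> + \<bar>t\<bar>) (Ep s (Ep t x)) = S (\<bar>s\<bar> + \<bar>t\<bar> + (s + t)) (P x)" .
qed auto

lemma Ep_0: "Ep 0 x = P x"
  by (simp add: Ep_forward)

lemma lin_Ep: "bounded_linear (Ep t)"
proof -
  have lin: "linear (Ep t)"
  proof (rule linearI)
    have n: "\<bar>t\<bar> \<ge> 0" "\<bar>t\<bar> + t \<ge> 0" by auto
    note lin = linear_simps[OF lin_S[OF n(1)]] linear_simps[OF lin_S[OF n(2)]]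
    fix x y c
    show "Ep t (x + y) = Ep t x + Ep t y"
      by (rule Ep_eqI[OF n]) (simp_all add: lin S_Ep n)
    show "Ep t (c *\<^sub>R x) = c *\<^sub>R Ep t x"
      by (rule Ep_eqI[OF n]) (simp_all add: lin S_Ep n)
  qed
  show ?thesis
  proof (cases "t \<ge> 0")
    case True
    have "Ep t = (\<lambda>x. S t (P x))"
      using True by (auto simp: Ep_forward)
    then show ?thesis
      using bounded_linear_compose[OF lin_S[OF True] lin_P] by simp
  next
    case False
    then have "norm (Ep t x) \<le> norm x * (K * exp (\<alpha> * t))" for x
      using bound_plus[of t x] by (simp add: Ep_def mult.commute)
    then show ?thesis
      by (intro bounded_linear_intro[OF linear_add[OF lin] linear_scale[OF lin]])
  qed
qed

lemma lin_Em: "t \<ge> 0 \<Longrightarrow> bounded_linear (Em t)"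
  unfolding Em_def
  by (intro bounded_linear_compose[OF lin_S] bounded_linear_sub bounded_linear_ident lin_P)

lemmas Ep_simps = linear_simps[OF lin_Ep]
lemmas Em_simps = linear_simps[OF lin_Em]
lemmas S_simps = linear_simps[OF lin_S]

lemma S_split: "t \<ge> 0 \<Longrightarrow> S t x = Ep t x + Em t x"
  by (simp add: Ep_forward Em_def S_simps)

lemma P_Em [simp]: "t \<ge> 0 \<Longrightarrow> P (Em t x) = 0"
  by (simp add: Em_def P_S S_simps)

lemma Em_Q: "t \<ge> 0 \<Longrightarrow> Em t (x - P x) = Em t x"
  by (simp add: Em_def)

lemma S_Em: "s \<ge> 0 \<Longrightarrow> t \<ge> 0 \<Longrightarrow> S s (Em t x) = Em (s + t) x"
  by (simp add: Em_def S_add)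

lemma Em_S: "s \<ge> 0 \<Longrightarrow> t \<ge> 0 \<Longrightarrow> Em s (S t x) = Em (s + t) x"
  by (simp add: Em_def S_add S_simps P_S)

lemma Ep_S: "t \<ge> 0 \<Longrightarrow> Ep s (S t x) = Ep (s + t) x"
  using Ep_P[of s "S t x"] by (simp add: P_S Ep_add Ep_forward)

lemma S_Ep': "s \<ge> 0 \<Longrightarrow> S s (Ep t x) = Ep (s + t) x"
  by (simp add: Ep_add Ep_forward)

lemma norm_Ep: "t \<le> 0 \<Longrightarrow> norm (Ep t x) \<le> K * exp (\<alpha> * t) * norm (P x)"
  using bound_plus[of t "P x"] by (simp add: Ep_def)

lemma norm_Em: "t \<ge> 0 \<Longrightarrow> norm (Em t x) \<le> K * exp (\<beta> * t) * norm (x - P x)"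
  using bound_minus[of t "x - P x"] by (simp add: Em_def)

lemma norm_Ep_le: "t \<le> 0 \<Longrightarrow> norm (Ep t x) \<le> K * norm x"
proof -
  assume t: "t \<le> 0"
  then have "K * exp (\<alpha> * t) * norm x \<le> K * 1 * norm x"
    using signs K_nonneg by (intro mult_right_mono mult_left_mono) (auto simp: mult_nonneg_nonpos)
  then show ?thesis
    using bound_plus[OF t, of x] by (simp add: Ep_def)
qed

lemma norm_Em_le: "t \<ge> 0 \<Longrightarrow> norm (Em t x) \<le> K * norm x"
proof -
  assume t: "t \<ge> 0"
  then have "K * exp (\<beta> * t) * norm x \<le> K * 1 * norm x"
    using signs K_nonneg by (intro mult_right_mono mult_left_mono) (auto simp: mult_nonpos_nonneg)
  then show ?thesis
    using bound_minus[OF t, of x] by (simp add: Em_def)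
qed

lemma tendsto_modulus: "((\<lambda>h. K * norm (S h x - x)) \<longlongrightarrow> 0) (at_right 0)"
  using tendsto_mult[OF tendsto_const[of K] tendsto_norm_zero[OF LIM_zero[OF S_right[of x]]]] by simp

text \<open>For \<open>s \<le> t \<le> 0\<close> the increment from \<open>s\<close> to \<open>t\<close> is \<open>Ep s\<close>, which is bounded by \<open>K\<close>, applied to the increment
  of the semigroup over the time \<open>t - s\<close>, which is small by strong continuity at \<open>0\<close>.\<close>
lemma continuous_Ep_backward: "continuous_on {..0} (\<lambda>t. Ep t x)"
proof (rule continuous_on_modulus[OF _ tendsto_modulus[of "P x"]])
  fix s t :: real assume st: "s \<le> t" "s \<in> {..0}"
  have "Ep t x = Ep s (Ep (t - s) x)"
    by (simp add: Ep_add[symmetric])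
  also have "Ep (t - s) x = S (t - s) (P x)"
    using st by (simp add: Ep_forward)
  finally have "Ep t x - Ep s x = Ep s (S (t - s) (P x) - P x)"
    by (simp add: Ep_simps)
  then show "norm (Ep t x - Ep s x) \<le> K * norm (S (t - s) (P x) - P x)"
    using norm_Ep_le[of s "S (t - s) (P x) - P x"] st by simp
qed

lemma continuous_Em: "continuous_on {0..} (\<lambda>t. Em t x)"
proof (rule continuous_on_modulus[OF _ tendsto_modulus[of "x - P x"]])
  fix s t :: real assume st: "s \<le> t" "s \<in> {0..}"
  then have "Em s (S (t - s) (x - P x)) = Em t x" "Em s (x - P x) = Em s x"
    by (simp_all add: Em_S Em_Q)
  then have "Em t x - Em s x = Em s (S (t - s) (x - P x) - (x - P x))"
    using Em_simps(2)[of s "S (t - s) (x - P x)" "x - P x"] st by simp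
  then show "norm (Em t x - Em s x) \<le> K * norm (S (t - s) (x - P x) - (x - P x))"
    using norm_Em_le[of s "S (t - s) (x - P x) - (x - P x)"] st by simp
qed

lemma continuous_on_Ep:
  assumes "continuous_on X \<tau>" "continuous_on X f"
  shows "continuous_on X (\<lambda>s. Ep (\<tau> s) (f s))"
proof -
  have base: "continuous_on ({..0} \<times> UNIV) (\<lambda>p. Ep (fst p) (snd p))"
    by (rule continuous_on_strong_joint[where C = K])
      (auto simp: Ep_simps(2)[symmetric] norm_Ep_le continuous_Ep_backward)
  have local: "continuous_on ({..<T} \<times> UNIV) (\<lambda>p. Ep (fst p) (snd p))" for T
  proof -
    \<comment> \<open>Up to time \<open>T\<close> the group is \<open>S \<bar>T\<bar>\<close> after the backward group, which is uniformly bounded.\<close>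
    have "continuous_on ({..<T} \<times> UNIV) (\<lambda>p::real \<times> 'a. (fst p - \<bar>T\<bar>, snd p))"
      by (intro continuous_intros)
    moreover have "(\<lambda>p::real \<times> 'a. (fst p - \<bar>T\<bar>, snd p)) ` ({..<T} \<times> UNIV) \<subseteq> {..0} \<times> UNIV"
      by auto
    ultimately have "continuous_on ({..<T} \<times> UNIV) (\<lambda>p. Ep (fst p - \<bar>T\<bar>) (snd p))"
      using continuous_on_compose2[OF base] by fastforce
    then have "continuous_on ({..<T} \<times> UNIV) (\<lambda>p. S \<bar>T\<bar> (Ep (fst p - \<bar>T\<bar>) (snd p)))"
      by (rule bounded_linear.continuous_on[OF lin_S[OF abs_ge_zero]])
    then show ?thesis
      by (simp add: S_Ep')
  qed
  have "continuous_on UNIV (\<lambda>p. Ep (fst p) (snd p))"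
  proof (rule continuous_at_imp_continuous_on, rule ballI)
    fix p :: "real \<times> 'a"
    have "open ({..<fst p + 1} \<times> (UNIV :: 'a set))" "p \<in> {..<fst p + 1} \<times> UNIV"
      by (auto intro: open_Times simp: mem_Times_iff)
    then show "isCont (\<lambda>p. Ep (fst p) (snd p)) p"
      using local[of "fst p + 1"] continuous_on_eq_continuous_at by blast
  qed
  from continuous_on_compose2[OF this continuous_on_Pair[OF assms]] show ?thesis
    by simp
qed

lemma continuous_on_Em:
  assumes "continuous_on X \<tau>" "continuous_on X f" "\<And>s. s \<in> X \<Longrightarrow> \<tau> s \<ge> 0"
  shows "continuous_on X (\<lambda>s. Em (\<tau> s) (f s))"
proof -
  have "continuous_on ({0..} \<times> UNIV) (\<lambda>p. Em (fst p) (snd p))"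
    by (rule continuous_on_strong_joint[where C = K])
      (auto simp: Em_simps(2)[symmetric] norm_Em_le continuous_Em)
  from continuous_on_compose2[OF this continuous_on_Pair[OF assms(1,2)]] show ?thesis
    using assms(3) by auto
qed

lemma continuous_on_S:
  assumes "continuous_on X \<tau>" "continuous_on X f" "\<And>s. s \<in> X \<Longrightarrow> \<tau> s \<ge> 0"
  shows "continuous_on X (\<lambda>s. S (\<tau> s) (f s))"
proof -
  have "continuous_on X (\<lambda>s. Ep (\<tau> s) (f s) + Em (\<tau> s) (f s))"
    by (intro continuous_on_add continuous_on_Ep continuous_on_Em assms)
  then show ?thesis
    by (rule continuous_on_eq) (simp add: S_split assms)
qed

end

section \<open>Bounded solutions of the inhomogeneous linear equation\<close>

text \<open>The variation of constants formula between the times \<open>s\<close> and \<open>t\<close> for \<open>dy/dt = A y + f\<close>, where \<open>A\<close>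
  generates \<open>S\<close>.\<close>
definition mild_step ::
    "(real \<Rightarrow> 'a \<Rightarrow> 'a) \<Rightarrow> (real \<Rightarrow> 'a::{banach, second_countable_topology}) \<Rightarrow> (real \<Rightarrow> 'a) \<Rightarrow> real \<Rightarrow> real \<Rightarrow> bool" where
  "mild_step S f y s t \<longleftrightarrow> y t = S (t - s) (y s) + (LBINT \<sigma>=s..t. S (t - \<sigma>) (f \<sigma>))"

lemma mild_step_cong:
  assumes "s \<le> t" "\<And>\<sigma>. s \<le> \<sigma> \<Longrightarrow> \<sigma> \<le> t \<Longrightarrow> y \<sigma> = y' \<sigma>" "\<And>\<sigma>. s \<le> \<sigma> \<Longrightarrow> \<sigma> \<le> t \<Longrightarrow> f \<sigma> = f' \<sigma>"
  shows "mild_step S f y s t \<longleftrightarrow> mild_step S f' y' s t"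
proof -
  have "(LBINT \<sigma>=s..t. S (t - \<sigma>) (f \<sigma>)) = (LBINT \<sigma>=s..t. S (t - \<sigma>) (f' \<sigma>))"
    using assms by (intro interval_integral_cong) (auto simp: einterval_iff)
  then show ?thesis
    using assms by (simp add: mild_step_def)
qed

context dichotomy
begin

text \<open>The kernel of the variation of constants formula for solutions that are bounded on the whole
  negative half line.\<close>
definition Green :: "real \<Rightarrow> 'a \<Rightarrow> 'a" where
  "Green \<tau> x = (if 0 \<le> \<tau> then Em \<tau> x else - Ep \<tau> x)"

text \<open>
  An upper bound for the norm of the Green kernel, apart from the factor \<open>K\<close>. Both exponentials count
  at \<open>\<tau> = 0\<close>, which makes the function symmetric in form and leaves its integral unchanged.
\<close>

definition Green_bound :: "real \<Rightarrow> real" where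
  "Green_bound \<tau> = indicator {0..} \<tau> * exp (\<beta> * \<tau>) + indicator {0..} (- \<tau>) * exp (\<alpha> * \<tau>)"

definition Green_int :: "(real \<Rightarrow> 'a) \<Rightarrow> real \<Rightarrow> 'a" where
  "Green_int f t = (\<integral>\<sigma>. indicator {..0} \<sigma> *\<^sub>R Green (t - \<sigma>) (f \<sigma>) \<partial>lborel)"

lemma norm_Green:
  assumes "norm (P x) \<le> M" "norm (x - P x) \<le> M"
  shows "norm (Green \<tau> x) \<le> K * M * Green_bound \<tau>"
proof -
  have M: "0 \<le> M"
    using assms norm_ge_zero order_trans by blast
  show ?thesis
  proof (cases "0 \<le> \<tau>")
    case True
    have "norm (Green \<tau> x) \<le> K * exp (\<beta> * \<tau>) * M"
      using norm_Em[OF True, of x] mult_left_mono[OF assms(2), of "K * exp (\<beta> * \<tau>)"] K_nonneg True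
      by (simp add: Green_def)
    also have "\<dots> \<le> K * M * Green_bound \<tau>"
      using K_nonneg M True mult_left_mono[of "exp (\<beta> * \<tau>)" "Green_bound \<tau>" "K * M"]
      by (simp add: Green_bound_def mult_ac)
    finally show ?thesis .
  next
    case False
    have "norm (Green \<tau> x) \<le> K * exp (\<alpha> * \<tau>) * M"
      using norm_Ep[of \<tau> x] mult_left_mono[OF assms(1), of "K * exp (\<alpha> * \<tau>)"] K_nonneg False
      by (simp add: Green_def)
    also have "\<dots> \<le> K * M * Green_bound \<tau>"
      using K_nonneg M False mult_left_mono[of "exp (\<alpha> * \<tau>)" "Green_bound \<tau>" "K * M"]
      by (simp add: Green_bound_def mult_ac)
    finally show ?thesis .
  qed
qed

lemma lin_Green: "bounded_linear (Green \<tau>)"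
  using lin_Em[of \<tau>] bounded_linear_minus[OF lin_Ep[of \<tau>]] by (cases "0 \<le> \<tau>") (simp_all add: Green_def[abs_def])

lemma measurable_Green [measurable]:
  assumes [measurable]: "\<tau> \<in> borel_measurable N" "f \<in> borel_measurable N"
  shows "(\<lambda>\<omega>. Green (\<tau> \<omega>) (f \<omega>)) \<in> borel_measurable N"
proof -
  have [measurable]: "(\<lambda>\<omega>. Ep (\<tau> \<omega>) (f \<omega>)) \<in> borel_measurable N"
    by (rule borel_measurable_continuous_Pair) (auto intro!: continuous_on_Ep continuous_intros)
  have [measurable]: "(\<lambda>\<omega>. Em (max (\<tau> \<omega>) 0) (f \<omega>)) \<in> borel_measurable N"
    by (rule borel_measurable_continuous_Pair[of \<tau> _ f "\<lambda>t. Em (max t 0)"])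
      (auto intro!: continuous_on_Em continuous_intros)
  have "(\<lambda>\<omega>. Green (\<tau> \<omega>) (f \<omega>)) = (\<lambda>\<omega>. if 0 \<le> \<tau> \<omega> then Em (max (\<tau> \<omega>) 0) (f \<omega>) else - Ep (\<tau> \<omega>) (f \<omega>))"
    by (auto simp: Green_def max_def fun_eq_iff)
  then show ?thesis
    by simp
qed

lemma has_bochner_integral_Green_bound: "has_bochner_integral lborel (\<lambda>\<sigma>. Green_bound (t - \<sigma>)) (1 / \<alpha> - 1 / \<beta>)"
proof -
  have half: "has_bochner_integral lborel (\<lambda>x. indicator {0..} x * exp (- a * x)) (1 / a)" if "a > 0" for a :: real
  proof (rule has_bochner_integral_nn_integral)
    have "((\<lambda>x. exp (- a * x)) has_integral 1 / a) {0..}"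
      using has_integral_exp_minus_to_infinity[OF that, of 0] by simp
    from nn_integral_has_integral_lebesgue[OF _ this]
    show "(\<integral>\<^sup>+ x. ennreal (indicator {0..} x * exp (- a * x)) \<partial>lborel) = ennreal (1 / a)"
      by simp
  qed (use that in auto)
  have "has_bochner_integral lborel (\<lambda>x. indicator {0..} (0 + (-1) * x) * exp (- \<alpha> * (0 + (-1) * x))) ((1 / \<alpha>) /\<^sub>R \<bar>-1\<bar>)"
    by (subst lborel_has_bochner_integral_real_affine_iff[symmetric]) (use half[of \<alpha>] signs in auto)
  from has_bochner_integral_add[OF half[of "- \<beta>"] this]
  have "has_bochner_integral lborel Green_bound (1 / \<alpha> - 1 / \<beta>)"
    using signs by (simp add: Green_bound_def[abs_def])
  then have "has_bochner_integral lborel (\<lambda>\<sigma>. Green_bound (t + (-1) * \<sigma>)) ((1 / \<alpha> - 1 / \<beta>) /\<^sub>R \<bar>-1\<bar>)"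
    by (subst lborel_has_bochner_integral_real_affine_iff[symmetric]) auto
  then show ?thesis
    by simp
qed

lemma measurable_Green_bound [measurable]: "Green_bound \<in> borel_measurable borel"
  unfolding Green_bound_def by measurable

lemma Green_bound_nonneg: "0 \<le> Green_bound \<tau>"
  by (simp add: Green_bound_def)

text \<open>Bounding the two components of \<open>f\<close> separately, as the Lipschitz condition on \<open>F\<close> does, keeps the norm
  of \<open>P\<close> out of the contraction constant.\<close>
definition bounded_forcing :: "real \<Rightarrow> (real \<Rightarrow> 'a) \<Rightarrow> bool" where
  "bounded_forcing M f \<longleftrightarrow> f \<in> borel_measurable borel \<and> (\<forall>\<sigma>\<le>0. norm (P (f \<sigma>)) \<le> M \<and> norm (f \<sigma> - P (f \<sigma>)) \<le> M)"

lemma forcing_integrand_le: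
  assumes "bounded_forcing M f"
  shows "norm (indicator {..0} \<sigma> *\<^sub>R Green (t - \<sigma>) (f \<sigma>)) \<le> K * M * Green_bound (t - \<sigma>)"
proof (cases "\<sigma> \<le> 0")
  case True
  then show ?thesis
    using assms norm_Green[of "f \<sigma>" M "t - \<sigma>"] by (auto simp: bounded_forcing_def)
next
  case False
  have "0 \<le> M"
    using assms norm_ge_zero order_trans unfolding bounded_forcing_def by blast
  then show ?thesis
    using False K_nonneg Green_bound_nonneg by simp
qed

lemma forcing_integrable:
  assumes "bounded_forcing M f"
  shows "integrable lborel (\<lambda>\<sigma>. indicator {..0} \<sigma> *\<^sub>R Green (t - \<sigma>) (f \<sigma>))"
proof (rule Bochner_Integration.integrable_bound)
  show "integrable lborel (\<lambda>\<sigma>. K * M * Green_bound (t - \<sigma>))"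
    using has_bochner_integral_Green_bound[of t] by (intro integrable_mult_right) (auto simp: has_bochner_integral_iff)
  have [measurable]: "f \<in> borel_measurable borel"
    using assms by (simp add: bounded_forcing_def)
  show "(\<lambda>\<sigma>. indicator {..0} \<sigma> *\<^sub>R Green (t - \<sigma>) (f \<sigma>)) \<in> borel_measurable lborel"
    by measurable
  show "AE \<sigma> in lborel. norm (indicator {..0} \<sigma> *\<^sub>R Green (t - \<sigma>) (f \<sigma>)) \<le> norm (K * M * Green_bound (t - \<sigma>))"
    unfolding real_norm_def by (rule AE_I2) (rule order_trans[OF forcing_integrand_le[OF assms] abs_ge_self])
qed

lemma norm_Green_int_le:
  assumes "bounded_forcing M f"
  shows "norm (Green_int f t) \<le> K * M * (1 / \<alpha> - 1 / \<beta>)"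
proof -
  have "norm (Green_int f t) \<le> (\<integral>\<sigma>. K * M * Green_bound (t - \<sigma>) \<partial>lborel)"
    unfolding Green_int_def
  proof (rule Bochner_Integration.integral_norm_bound_integral[OF forcing_integrable[OF assms] _ forcing_integrand_le[OF assms]])
    show "integrable lborel (\<lambda>\<sigma>. K * M * Green_bound (t - \<sigma>))"
      using has_bochner_integral_Green_bound[of t] by (simp add: has_bochner_integral_iff)
  qed
  also have "\<dots> = K * M * (1 / \<alpha> - 1 / \<beta>)"
    using has_bochner_integral_Green_bound[of t] by (simp add: has_bochner_integral_iff)
  finally show ?thesis .
qed

lemma Green_int_diff:
  assumes "bounded_forcing M f" "bounded_forcing M' g"
  shows "Green_int f t - Green_int g t = Green_int (\<lambda>\<sigma>. f \<sigma> - g \<sigma>) t"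
  unfolding Green_int_def
  by (subst Bochner_Integration.integral_diff[symmetric])
    (auto intro!: forcing_integrable assms simp: linear_simps[OF lin_Green] scaleR_diff_right)

text \<open>After the substitution \<open>\<tau> = t - \<sigma>\<close> the integrand is dominated independently of \<open>t\<close>, and it is
  continuous in \<open>t\<close> except where \<open>\<tau> = t\<close>.\<close>
lemma continuous_Green_int:
  assumes f: "bounded_forcing M f" "continuous_on UNIV f"
  shows "continuous_on UNIV (Green_int f)"
proof -
  have shifted: "Green_int f t = (\<integral>\<tau>. indicator {..0} (t - \<tau>) *\<^sub>R Green \<tau> (f (t - \<tau>)) \<partial>lborel)" for t
    unfolding Green_int_def by (subst lborel_integral_real_affine[where c = "-1" and t = t]) auto
  have [measurable]: "f \<in> borel_measurable borel"
    using f by (simp add: bounded_forcing_def)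
  have "(\<lambda>n. Green_int f (x n)) \<longlonglongrightarrow> Green_int f t" if x: "x \<longlonglongrightarrow> t" for x :: "nat \<Rightarrow> real" and t
    unfolding shifted
  proof (rule integral_dominated_convergence)
    show "integrable lborel (\<lambda>\<tau>. K * M * Green_bound \<tau>)"
      using has_bochner_integral_Green_bound[of 0] lborel_integrable_real_affine_iff[of "-1" Green_bound 0]
      by (intro integrable_mult_right) (auto simp: has_bochner_integral_iff)
    show "AE \<tau> in lborel. norm (indicator {..0} (x n - \<tau>) *\<^sub>R Green \<tau> (f (x n - \<tau>))) \<le> K * M * Green_bound \<tau>" for n
    proof (rule AE_I2)
      fix \<tau>
      show "norm (indicator {..0} (x n - \<tau>) *\<^sub>R Green \<tau> (f (x n - \<tau>))) \<le> K * M * Green_bound \<tau>"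
        using forcing_integrand_le[OF f(1), of "x n - \<tau>" "x n"] by simp
    qed
    show "AE \<tau> in lborel. (\<lambda>n. indicator {..0} (x n - \<tau>) *\<^sub>R Green \<tau> (f (x n - \<tau>)))
        \<longlonglongrightarrow> indicator {..0} (t - \<tau>) *\<^sub>R Green \<tau> (f (t - \<tau>))"
      using AE_lborel_singleton[of t]
    proof eventually_elim
      case (elim \<tau>)
      have lim: "(\<lambda>n. x n - \<tau>) \<longlonglongrightarrow> t - \<tau>"
        by (intro tendsto_intros x)
      have "\<forall>\<^sub>F n in sequentially. indicator {..0} (x n - \<tau>) = (indicator {..0} (t - \<tau>) :: real)"
      proof (cases "t < \<tau>")
        case True
        with order_tendstoD(2)[OF lim, of 0] show ?thesis
          by (auto elim!: eventually_mono simp: indicator_def)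
      next
        case False
        with elim order_tendstoD(1)[OF lim, of 0] show ?thesis
          by (auto elim!: eventually_mono simp: indicator_def)
      qed
      then have "(\<lambda>n. indicator {..0} (x n - \<tau>)) \<longlonglongrightarrow> (indicator {..0} (t - \<tau>) :: real)"
        by (rule tendsto_eventually)
      moreover have "(\<lambda>n. Green \<tau> (f (x n - \<tau>))) \<longlonglongrightarrow> Green \<tau> (f (t - \<tau>))"
        by (rule bounded_linear.tendsto[OF lin_Green continuous_on_tendsto_compose[OF f(2) lim]]) auto
      ultimately show ?case
        by (rule tendsto_scaleR)
    qed
  qed measurable
  then show ?thesis
    by (auto simp: continuous_on_sequentially o_def)
qed

lemma set_integrable_Em:
  assumes "bounded_forcing M f" "t \<le> 0"
  shows "set_integrable lborel {..t} (\<lambda>\<sigma>. Em (t - \<sigma>) (f \<sigma>))"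
proof -
  have "integrable lborel (\<lambda>\<sigma>. indicator {..t} \<sigma> *\<^sub>R (indicator {..0} \<sigma> *\<^sub>R Green (t - \<sigma>) (f \<sigma>)))"
    by (rule integrable_mult_indicator[OF _ forcing_integrable[OF assms(1)]]) simp
  then show ?thesis
    unfolding set_integrable_def
    by (rule Bochner_Integration.integrable_cong[THEN iffD1, rotated 2])
      (use assms in \<open>auto simp: Green_def indicator_def\<close>)
qed

lemma Green_int_decompose:
  assumes "bounded_forcing M f" "t \<le> 0"
  shows "Green_int f t = (LINT \<sigma>:{..t}|lborel. Em (t - \<sigma>) (f \<sigma>)) - (LBINT \<sigma>=t..0. Ep (t - \<sigma>) (f \<sigma>))"
proof -
  have "integrable lborel (\<lambda>\<sigma>. indicator {t<..0} \<sigma> *\<^sub>R (indicator {..0} \<sigma> *\<^sub>R Green (t - \<sigma>) (f \<sigma>)))"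
    by (rule integrable_mult_indicator[OF _ forcing_integrable[OF assms(1)]]) simp
  then have int: "integrable lborel (\<lambda>\<sigma>. - (indicator {t<..0} \<sigma> *\<^sub>R Ep (t - \<sigma>) (f \<sigma>)))"
    by (rule Bochner_Integration.integrable_cong[THEN iffD1, rotated 2])
      (auto simp: Green_def indicator_def)
  have "Green_int f t = (\<integral>\<sigma>. indicator {..t} \<sigma> *\<^sub>R Em (t - \<sigma>) (f \<sigma>) - indicator {t<..0} \<sigma> *\<^sub>R Ep (t - \<sigma>) (f \<sigma>) \<partial>lborel)"
    unfolding Green_int_def
    by (intro Bochner_Integration.integral_cong) (use assms in \<open>auto simp: Green_def indicator_def\<close>)
  also have "\<dots> = (LINT \<sigma>:{..t}|lborel. Em (t - \<sigma>) (f \<sigma>)) - (LINT \<sigma>:{t<..0}|lborel. Ep (t - \<sigma>) (f \<sigma>))"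
    unfolding set_lebesgue_integral_def
    using int set_integrable_Em[OF assms] by (intro Bochner_Integration.integral_diff) (auto simp: set_integrable_def)
  also have "(LINT \<sigma>:{t<..0}|lborel. Ep (t - \<sigma>) (f \<sigma>)) = (LBINT \<sigma>=t..0. Ep (t - \<sigma>) (f \<sigma>))"
    using interval_integral_Ioc[of t 0 "\<lambda>\<sigma>. Ep (t - \<sigma>) (f \<sigma>)"] assms(2)
    by (simp add: zero_ereal_def)
  finally show ?thesis .
qed

lemma continuous_on_integrands:
  assumes "continuous_on UNIV f"
  shows "continuous_on {s..t} (\<lambda>\<sigma>. S (t - \<sigma>) (f \<sigma>))"
    and "continuous_on {s..t} (\<lambda>\<sigma>. Em (t - \<sigma>) (f \<sigma>))"
    and "continuous_on X (\<lambda>\<sigma>. Ep (t - \<sigma>) (f \<sigma>))"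
  by (auto intro!: continuous_on_S continuous_on_Em continuous_on_Ep continuous_intros
      intro: continuous_on_subset[OF assms])

text \<open>The unstable component is determined by solving the mild equation between \<open>t\<close> and \<open>0\<close> backwards.
  The stable component is obtained from the mild equation between \<open>s\<close> and \<open>t\<close> by letting \<open>s\<close> tend to
  \<open>-\<infinity>\<close>: since \<open>y\<close> is bounded, the contribution of the initial value decays like \<open>exp (\<beta> (t - s))\<close>.\<close>
lemma bounded_mild_imp_Green:
  assumes y: "bounded (y ` {..0})"
    and f: "bounded_forcing M f" "continuous_on UNIV f"
    and mild: "\<And>s t. s \<le> t \<Longrightarrow> t \<le> 0 \<Longrightarrow> mild_step S f y s t"
    and t: "t \<le> 0"
  shows "y t = Ep t (y 0) + Green_int f t"
proof -
  have "Ep t (y 0) = Ep t (S (0 - t) (y t)) + Ep t (LBINT \<sigma>=t..0. S (0 - \<sigma>) (f \<sigma>))"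
    using mild[OF t order_refl] by (simp add: mild_step_def Ep_simps zero_ereal_def)
  also have "Ep t (S (0 - t) (y t)) = P (y t)"
    using t by (simp add: Ep_S Ep_0)
  also have "Ep t (LBINT \<sigma>=t..0. S (0 - \<sigma>) (f \<sigma>)) = (LBINT \<sigma>=t..0. Ep t (S (0 - \<sigma>) (f \<sigma>)))"
    using interval_integral_bounded_linear[OF lin_Ep t continuous_on_integrands(1)[OF f(2), of t 0]] by (simp add: zero_ereal_def)
  also have "\<dots> = (LBINT \<sigma>=t..0. Ep (t - \<sigma>) (f \<sigma>))"
    using t by (intro interval_integral_cong) (auto simp: Ep_S einterval_iff zero_ereal_def)
  finally have plus: "P (y t) = Ep t (y 0) - (LBINT \<sigma>=t..0. Ep (t - \<sigma>) (f \<sigma>))"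
    by simp
  have minus: "y t - P (y t) = Em (t - s) (y s) + (LINT \<sigma>:{s..t}|lborel. Em (t - \<sigma>) (f \<sigma>))" if s: "s \<le> t" for s
  proof -
    have "y t - P (y t) = Em 0 (S (t - s) (y s)) + Em 0 (LBINT \<sigma>=s..t. S (t - \<sigma>) (f \<sigma>))"
      using mild[OF s t] by (simp add: mild_step_def Em_def algebra_simps)
    also have "Em 0 (LBINT \<sigma>=s..t. S (t - \<sigma>) (f \<sigma>)) = (LBINT \<sigma>=s..t. Em 0 (S (t - \<sigma>) (f \<sigma>)))"
      using interval_integral_bounded_linear[OF lin_Em s continuous_on_integrands(1)[OF f(2)]] by simp
    also have "\<dots> = (LBINT \<sigma>=s..t. Em (t - \<sigma>) (f \<sigma>))"
      using s by (intro interval_integral_cong) (auto simp: Em_S einterval_iff)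
    finally show ?thesis
      using s by (simp add: Em_S interval_integral_Icc)
  qed
  have ev: "\<forall>\<^sub>F s in at_bot. (LINT \<sigma>:{s..t}|lborel. Em (t - \<sigma>) (f \<sigma>)) = y t - P (y t) - Em (t - s) (y s)"
    using eventually_le_at_bot[of t] by eventually_elim (simp add: minus)
  from y obtain B where B: "\<And>s. s \<le> 0 \<Longrightarrow> norm (y s) \<le> B"
    by (auto simp: bounded_iff)
  have "((\<lambda>s. Em (t - s) (y s)) \<longlongrightarrow> 0) at_bot"
  proof (rule Lim_null_comparison)
    show "\<forall>\<^sub>F s in at_bot. norm (Em (t - s) (y s)) \<le> K * exp (\<beta> * (t + - s)) * B"
      using eventually_le_at_bot[of t]
    proof eventually_elim
      case (elim s)
      then have "norm (Em (t - s) (y s)) \<le> K * exp (\<beta> * (t - s)) * norm (y s)"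
        using bound_minus[of "t - s" "y s"] by (simp add: Em_def)
      also have "\<dots> \<le> K * exp (\<beta> * (t - s)) * B"
        using elim t K_nonneg by (intro mult_left_mono B) auto
      finally show ?case by simp
    qed
    have "LIM s at_bot. \<beta> * (t + - s) :> at_bot"
      by (intro filterlim_tendsto_neg_mult_at_bot[OF tendsto_const signs(1)]
          filterlim_tendsto_add_at_top[OF tendsto_const] filterlim_uminus_at_top_at_bot)
    from filterlim_compose[OF exp_at_bot this]
    have "((\<lambda>s. K * exp (\<beta> * (t + - s)) * B) \<longlongrightarrow> K * 0 * B) at_bot"
      by (intro tendsto_intros)
    then show "((\<lambda>s. K * exp (\<beta> * (t + - s)) * B) \<longlongrightarrow> 0) at_bot"
      by simp
  qed
  then have "((\<lambda>s. y t - P (y t) - Em (t - s) (y s)) \<longlongrightarrow> y t - P (y t) - 0) at_bot"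
    by (intro tendsto_intros)
  with tendsto_cong[OF ev] have "((\<lambda>s. LINT \<sigma>:{s..t}|lborel. Em (t - \<sigma>) (f \<sigma>)) \<longlongrightarrow> y t - P (y t)) at_bot"
    by simp
  moreover have "((\<lambda>s. LINT \<sigma>:{s..t}|lborel. Em (t - \<sigma>) (f \<sigma>)) \<longlongrightarrow> (LINT \<sigma>:{..t}|lborel. Em (t - \<sigma>) (f \<sigma>))) at_bot"
    by (rule tendsto_set_lebesgue_integral_at_bot[OF _ set_integrable_Em[OF f(1) t]]) simp
  ultimately have minus: "y t - P (y t) = (LINT \<sigma>:{..t}|lborel. Em (t - \<sigma>) (f \<sigma>))"
    by (rule tendsto_unique[OF trivial_limit_at_bot_linorder])
  have "y t = P (y t) + (y t - P (y t))"
    by simp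
  also have "\<dots> = (Ep t (y 0) - (LBINT \<sigma>=t..0. Ep (t - \<sigma>) (f \<sigma>))) + (LINT \<sigma>:{..t}|lborel. Em (t - \<sigma>) (f \<sigma>))"
    by (rule arg_cong2[where f = "(+)", OF plus minus])
  finally show ?thesis
    by (simp add: Green_int_decompose[OF f(1) t])
qed

text \<open>Applying \<open>S (t - s)\<close> to the formula at time \<open>s\<close> only changes the time argument of the kernels; the
  formula at time \<open>t\<close> differs from the result by the integrals over the interval from \<open>s\<close> to \<open>t\<close>.\<close>
lemma Green_imp_mild:
  assumes f: "bounded_forcing M f" "continuous_on UNIV f"
    and y: "\<And>t. t \<le> 0 \<Longrightarrow> y t = Ep t x + Green_int f t"
    and st: "s \<le> t" "t \<le> 0"
  shows "mild_step S f y s t"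
proof -
  have s: "s \<le> 0" and ts: "0 \<le> t - s" using st by auto
  have linS: "bounded_linear (S (t - s))"
    by (rule lin_S[OF ts])
  have stable: "S (t - s) (LINT \<sigma>:{..s}|lborel. Em (s - \<sigma>) (f \<sigma>)) = (LINT \<sigma>:{..s}|lborel. Em (t - \<sigma>) (f \<sigma>))"
  proof -
    have "S (t - s) (LINT \<sigma>:{..s}|lborel. Em (s - \<sigma>) (f \<sigma>)) =
        (\<integral>\<sigma>. S (t - s) (indicator {..s} \<sigma> *\<^sub>R Em (s - \<sigma>) (f \<sigma>)) \<partial>lborel)"
      unfolding set_lebesgue_integral_def
      using set_integrable_Em[OF f(1) s] by (intro integral_bounded_linear[OF linS, symmetric]) (simp add: set_integrable_def)
    also have "\<dots> = (LINT \<sigma>:{..s}|lborel. Em (t - \<sigma>) (f \<sigma>))"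
      unfolding set_lebesgue_integral_def
      using ts by (intro Bochner_Integration.integral_cong) (auto simp: linear_simps[OF linS] S_Em indicator_def)
    finally show ?thesis .
  qed
  have unstable: "S (t - s) (LBINT \<sigma>=s..0. Ep (s - \<sigma>) (f \<sigma>)) = (LBINT \<sigma>=s..0. Ep (t - \<sigma>) (f \<sigma>))"
    using interval_integral_bounded_linear[OF linS s continuous_on_integrands(3)[OF f(2), of _ s]] ts
    by (simp add: S_Ep' zero_ereal_def)
  have "(LINT \<sigma>:{..t}|lborel. Em (t - \<sigma>) (f \<sigma>)) =
      (LINT \<sigma>:{..s}|lborel. Em (t - \<sigma>) (f \<sigma>)) + (LINT \<sigma>:{s<..t}|lborel. Em (t - \<sigma>) (f \<sigma>))"
  proof -
    have "{..t} = {..s} \<union> {s<..t}" "{..s} \<inter> {s<..t} = {}"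
      using st by auto
    moreover have "set_integrable lborel {..s} (\<lambda>\<sigma>. Em (t - \<sigma>) (f \<sigma>))"
      "set_integrable lborel {s<..t} (\<lambda>\<sigma>. Em (t - \<sigma>) (f \<sigma>))"
      by (rule set_integrable_subset[OF set_integrable_Em[OF f(1) st(2)]]; use st in auto)+
    ultimately show ?thesis
      using set_integral_Un[of "{..s}" "{s<..t}" lborel "\<lambda>\<sigma>. Em (t - \<sigma>) (f \<sigma>)"] by simp
  qed
  then have minus: "(LINT \<sigma>:{..t}|lborel. Em (t - \<sigma>) (f \<sigma>)) =
      (LINT \<sigma>:{..s}|lborel. Em (t - \<sigma>) (f \<sigma>)) + (LBINT \<sigma>=s..t. Em (t - \<sigma>) (f \<sigma>))"
    using st by (simp add: interval_integral_Ioc)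
  have plus: "(LBINT \<sigma>=s..0. Ep (t - \<sigma>) (f \<sigma>)) = (LBINT \<sigma>=s..t. Ep (t - \<sigma>) (f \<sigma>)) + (LBINT \<sigma>=t..0. Ep (t - \<sigma>) (f \<sigma>))"
    using interval_integral_combine[OF st continuous_on_integrands(3)[OF f(2), of _ t]] by (simp add: zero_ereal_def)
  have "(LBINT \<sigma>=s..t. S (t - \<sigma>) (f \<sigma>)) = (LBINT \<sigma>=s..t. Ep (t - \<sigma>) (f \<sigma>) + Em (t - \<sigma>) (f \<sigma>))"
    using st by (intro interval_integral_cong) (auto simp: S_split einterval_iff)
  also have "\<dots> = (LBINT \<sigma>=s..t. Ep (t - \<sigma>) (f \<sigma>)) + (LBINT \<sigma>=s..t. Em (t - \<sigma>) (f \<sigma>))"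
    using st by (intro interval_lebesgue_integral_add interval_integrable_continuous_on continuous_on_integrands f)
  finally show ?thesis
    unfolding mild_step_def y[OF s] y[OF st(2)] Green_int_decompose[OF f(1) s] Green_int_decompose[OF f(1) st(2)]
      linear_simps[OF linS] stable unstable minus plus
    using ts by (simp add: S_Ep' algebra_simps)
qed

lemma P_Green_int_0: "bounded_forcing M f \<Longrightarrow> P (Green_int f 0) = 0"
proof -
  assume f: "bounded_forcing M f"
  have "P (Green_int f 0) = (\<integral>\<sigma>. P (indicator {..0} \<sigma> *\<^sub>R Green (0 - \<sigma>) (f \<sigma>)) \<partial>lborel)"
    unfolding Green_int_def by (rule integral_bounded_linear[OF lin_P forcing_integrable[OF f], symmetric])
  also have "(\<lambda>\<sigma>. P (indicator {..0} \<sigma> *\<^sub>R Green (0 - \<sigma>) (f \<sigma>))) = (\<lambda>\<sigma>. 0)"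
    by (auto simp: fun_eq_iff Green_def indicator_def)
  finally show ?thesis by simp
qed

end

section \<open>The Lyapunov--Perron fixed point\<close>

context dichotomy
begin

text \<open>Expanding \<open>y t\<close> in the equation from \<open>t\<close> to \<open>r\<close> yields the equation from \<open>s\<close> to \<open>r\<close>, so each of the two
  implies the other. This lets solutions be glued at time \<open>0\<close> and also be restarted at later times.\<close>
lemma mild_step_concat:
  assumes st: "s \<le> t" "t \<le> r" and f: "continuous_on UNIV f" and mild: "mild_step S f y s t"
  shows "mild_step S f y t r \<longleftrightarrow> mild_step S f y s r"
proof -
  have rt: "0 \<le> r - t"
    using st by simp
  have "S (r - t) (y t) = S (r - t) (S (t - s) (y s)) + S (r - t) (LBINT \<sigma>=s..t. S (t - \<sigma>) (f \<sigma>))"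
    using mild unfolding mild_step_def by (simp only: S_simps(1)[OF rt])
  also have "S (r - t) (S (t - s) (y s)) = S (r - s) (y s)"
    using S_add[of "r - t" "t - s" "y s"] st by simp
  also have "S (r - t) (LBINT \<sigma>=s..t. S (t - \<sigma>) (f \<sigma>)) = (LBINT \<sigma>=s..t. S (r - t) (S (t - \<sigma>) (f \<sigma>)))"
    by (rule interval_integral_bounded_linear[OF lin_S[OF rt] st(1) continuous_on_integrands(1)[OF f], symmetric])
  also have "\<dots> = (LBINT \<sigma>=s..t. S (r - \<sigma>) (f \<sigma>))"
  proof (rule interval_integral_cong)
    fix \<sigma> assume "\<sigma> \<in> einterval (min (ereal s) (ereal t)) (max (ereal s) (ereal t))"
    then show "S (r - t) (S (t - \<sigma>) (f \<sigma>)) = S (r - \<sigma>) (f \<sigma>)"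
      using st S_add[of "r - t" "t - \<sigma>" "f \<sigma>"] by (simp add: einterval_iff)
  qed
  finally have "S (r - t) (y t) = S (r - s) (y s) + (LBINT \<sigma>=s..t. S (r - \<sigma>) (f \<sigma>))" .
  moreover have "(LBINT \<sigma>=s..t. S (r - \<sigma>) (f \<sigma>)) + (LBINT \<sigma>=t..r. S (r - \<sigma>) (f \<sigma>)) = (LBINT \<sigma>=s..r. S (r - \<sigma>) (f \<sigma>))"
    by (rule interval_integral_combine[OF st continuous_on_integrands(1)[OF f]])
  ultimately have "S (r - t) (y t) + (LBINT \<sigma>=t..r. S (r - \<sigma>) (f \<sigma>)) =
      S (r - s) (y s) + (LBINT \<sigma>=s..r. S (r - \<sigma>) (f \<sigma>))"
    by (simp only: add.assoc)
  then show ?thesis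
    by (simp only: mild_step_def)
qed

text \<open>The hypotheses on a time-dependent nonlinearity under which the fixed point argument works.\<close>
definition admissible :: "real \<Rightarrow> (real \<Rightarrow> 'a \<Rightarrow> 'a) \<Rightarrow> bool" where
  "admissible L g \<longleftrightarrow>
     continuous_on UNIV (\<lambda>p. g (fst p) (snd p)) \<and> (\<forall>\<sigma>. g \<sigma> 0 = 0) \<and> 0 \<le> L \<and>
     (\<forall>\<sigma> x y. norm (P (g \<sigma> x - g \<sigma> y)) \<le> L * norm (x - y) \<and>
        norm ((g \<sigma> x - g \<sigma> y) - P (g \<sigma> x - g \<sigma> y)) \<le> L * norm (x - y))"

definition contraction :: "real \<Rightarrow> real" where
  "contraction L = K * L * (1 / \<alpha> - 1 / \<beta>)"

text \<open>Time is frozen at \<open>0\<close> for positive arguments, so that the operator acts on bounded continuous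
  functions on the whole line, which form a complete metric space.\<close>
definition LP_map :: "(real \<Rightarrow> 'a \<Rightarrow> 'a) \<Rightarrow> 'a \<Rightarrow> (real \<Rightarrow> 'a) \<Rightarrow> real \<Rightarrow> 'a" where
  "LP_map g \<xi> y t = Ep (min t 0) \<xi> + Green_int (\<lambda>\<sigma>. g \<sigma> (y \<sigma>)) (min t 0)"

lemma contraction_nonneg: "0 \<le> L \<Longrightarrow> 0 \<le> contraction L"
proof -
  assume "0 \<le> L"
  moreover have "1 / \<beta> < 0" "0 < 1 / \<alpha>"
    using signs by auto
  then have "0 \<le> 1 / \<alpha> - 1 / \<beta>"
    by linarith
  ultimately show ?thesis
    using K_nonneg unfolding contraction_def by (intro mult_nonneg_nonneg)
qed

lemma admissibleD:
  assumes "admissible L g"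
  shows "continuous_on UNIV (\<lambda>p. g (fst p) (snd p))" "g \<sigma> 0 = 0" "0 \<le> L"
    "norm (P (g \<sigma> x - g \<sigma> y)) \<le> L * norm (x - y)"
    "norm ((g \<sigma> x - g \<sigma> y) - P (g \<sigma> x - g \<sigma> y)) \<le> L * norm (x - y)"
  using assms unfolding admissible_def by blast+

lemma continuous_on_g:
  assumes "admissible L g" "continuous_on UNIV y"
  shows "continuous_on UNIV (\<lambda>\<sigma>. g \<sigma> (y \<sigma>))"
  using continuous_on_compose2[OF admissibleD(1)[OF assms(1)] continuous_on_Pair[OF continuous_on_id assms(2)]] by simp

lemma measurable_g:
  assumes "admissible L g" "y \<in> borel_measurable borel"
  shows "(\<lambda>\<sigma>. g \<sigma> (y \<sigma>)) \<in> borel_measurable borel"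
  by (rule borel_measurable_continuous_Pair[of "\<lambda>\<sigma>. \<sigma>" _ y g])
    (simp_all add: assms(2) admissibleD(1)[OF assms(1)])

lemma forcing_g_diff:
  assumes adm: "admissible L g" and "y \<in> borel_measurable borel" "y' \<in> borel_measurable borel"
    and d: "\<And>\<sigma>. \<sigma> \<le> 0 \<Longrightarrow> norm (y \<sigma> - y' \<sigma>) \<le> d"
  shows "bounded_forcing (L * d) (\<lambda>\<sigma>. g \<sigma> (y \<sigma>) - g \<sigma> (y' \<sigma>))"
  unfolding bounded_forcing_def
proof (intro conjI allI impI)
  show "(\<lambda>\<sigma>. g \<sigma> (y \<sigma>) - g \<sigma> (y' \<sigma>)) \<in> borel_measurable borel"
    by (rule borel_measurable_diff[OF measurable_g[OF adm assms(2)] measurable_g[OF adm assms(3)]])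
  fix \<sigma> :: real assume "\<sigma> \<le> 0"
  then have "L * norm (y \<sigma> - y' \<sigma>) \<le> L * d"
    by (intro mult_left_mono d admissibleD(3)[OF adm])
  then show "norm (P (g \<sigma> (y \<sigma>) - g \<sigma> (y' \<sigma>))) \<le> L * d"
    "norm (g \<sigma> (y \<sigma>) - g \<sigma> (y' \<sigma>) - P (g \<sigma> (y \<sigma>) - g \<sigma> (y' \<sigma>))) \<le> L * d"
    by (rule order_trans[OF admissibleD(4)[OF adm]], rule order_trans[OF admissibleD(5)[OF adm]])
qed

lemma forcing_g:
  assumes "admissible L g" "y \<in> borel_measurable borel" "\<And>\<sigma>. \<sigma> \<le> 0 \<Longrightarrow> norm (y \<sigma>) \<le> B"
  shows "bounded_forcing (L * B) (\<lambda>\<sigma>. g \<sigma> (y \<sigma>))"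
  using forcing_g_diff[of L g y "\<lambda>_. 0" B] assms by (simp add: admissibleD(2)[OF assms(1)])

text \<open>The single estimate behind existence and uniqueness of the fixed point, its Lipschitz dependence on
  \<open>\<xi>\<close>, and the convergence of the Picard iterates.\<close>
lemma LP_map_diff_le:
  assumes adm: "admissible L g"
    and y: "y \<in> borel_measurable borel" "bounded (y ` {..0})"
    and y': "y' \<in> borel_measurable borel" "bounded (y' ` {..0})"
    and d: "\<And>\<sigma>. \<sigma> \<le> 0 \<Longrightarrow> norm (y \<sigma> - y' \<sigma>) \<le> d"
  shows "norm (LP_map g \<xi> y t - LP_map g \<xi>' y' t) \<le> K * norm (\<xi> - \<xi>') + contraction L * d"
proof -
  from y(2) y'(2) obtain B B' where B: "\<And>\<sigma>. \<sigma> \<le> 0 \<Longrightarrow> norm (y \<sigma>) \<le> B" "\<And>\<sigma>. \<sigma> \<le> 0 \<Longrightarrow> norm (y' \<sigma>) \<le> B'"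
    by (auto simp: bounded_iff)
  have "Green_int (\<lambda>\<sigma>. g \<sigma> (y \<sigma>)) s - Green_int (\<lambda>\<sigma>. g \<sigma> (y' \<sigma>)) s = Green_int (\<lambda>\<sigma>. g \<sigma> (y \<sigma>) - g \<sigma> (y' \<sigma>)) s" for s
    by (rule Green_int_diff[OF forcing_g[OF adm y(1) B(1)] forcing_g[OF adm y'(1) B(2)]])
  then have "LP_map g \<xi> y t - LP_map g \<xi>' y' t =
      Ep (min t 0) (\<xi> - \<xi>') + Green_int (\<lambda>\<sigma>. g \<sigma> (y \<sigma>) - g \<sigma> (y' \<sigma>)) (min t 0)"
    by (simp add: LP_map_def Ep_simps algebra_simps)
  also have "norm \<dots> \<le> K * norm (\<xi> - \<xi>') + K * (L * d) * (1 / \<alpha> - 1 / \<beta>)"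
    using norm_Green_int_le[OF forcing_g_diff[OF adm y(1) y'(1) d]]
    by (intro order_trans[OF norm_triangle_ineq] add_mono norm_Ep_le) auto
  finally show ?thesis
    by (simp add: contraction_def mult_ac)
qed

lemma LP_map_zero:
  assumes "admissible L g"
  shows "LP_map g 0 (\<lambda>_. 0) t = 0"
  by (simp add: LP_map_def admissibleD(2)[OF assms] Green_int_def Ep_simps linear_simps[OF lin_Green])

lemma bounded_LP_map:
  assumes adm: "admissible L g" and y: "y \<in> borel_measurable borel" "bounded (y ` {..0})"
  shows "bounded (range (LP_map g \<xi> y))"
proof -
  from y(2) obtain B where B: "\<And>\<sigma>. \<sigma> \<le> 0 \<Longrightarrow> norm (y \<sigma>) \<le> B"
    by (auto simp: bounded_iff)
  have "norm (LP_map g \<xi> y t) \<le> K * norm \<xi> + contraction L * B" for t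
    using LP_map_diff_le[OF adm y, of "\<lambda>_. 0" B \<xi> t 0] B LP_map_zero[OF adm]
    by (simp add: image_constant_conv)
  then show ?thesis
    by (auto simp: bounded_iff)
qed

lemma continuous_LP_map:
  assumes adm: "admissible L g" and y: "continuous_on UNIV y" "bounded (y ` {..0})"
  shows "continuous_on UNIV (LP_map g \<xi> y)"
proof -
  from y(2) obtain B where "\<And>\<sigma>. \<sigma> \<le> 0 \<Longrightarrow> norm (y \<sigma>) \<le> B"
    by (auto simp: bounded_iff)
  then have "bounded_forcing (L * B) (\<lambda>\<sigma>. g \<sigma> (y \<sigma>))"
    by (rule forcing_g[OF adm borel_measurable_continuous_onI[OF y(1)]])
  from continuous_Green_int[OF this continuous_on_g[OF adm y(1)]]
  have Green_int: "continuous_on UNIV (Green_int (\<lambda>\<sigma>. g \<sigma> (y \<sigma>)))" .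
  have min: "continuous_on UNIV (\<lambda>t::real. min t 0)"
    by (intro continuous_intros)
  show ?thesis
    unfolding LP_map_def
    by (rule continuous_on_add[OF continuous_on_Ep[OF min continuous_on_const] continuous_on_compose2[OF Green_int min]]) simp
qed

definition LP_fixpoint :: "(real \<Rightarrow> 'a \<Rightarrow> 'a) \<Rightarrow> 'a \<Rightarrow> (real \<Rightarrow> 'a) \<Rightarrow> bool" where
  "LP_fixpoint g \<xi> y \<longleftrightarrow> continuous_on UNIV y \<and> bounded (range y) \<and> (\<forall>t. y t = LP_map g \<xi> y t)"

lemma LP_fixpoint_exists:
  assumes adm: "admissible L g" and contr: "contraction L < 1"
  shows "\<exists>y. LP_fixpoint g \<xi> y"
proof -
  define T :: "(real \<Rightarrow>\<^sub>C 'a) \<Rightarrow> (real \<Rightarrow>\<^sub>C 'a)" where "T y = Bcontfun (LP_map g \<xi> y)" for y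
  have b: "bounded (apply_bcontfun y ` {..0})" for y :: "real \<Rightarrow>\<^sub>C 'a"
    by (rule bounded_subset[OF bounded_apply_bcontfun]) auto
  have m: "apply_bcontfun y \<in> borel_measurable borel" for y :: "real \<Rightarrow>\<^sub>C 'a"
    by (rule borel_measurable_continuous_onI) simp
  have T: "apply_bcontfun (T y) = LP_map g \<xi> y" for y
    unfolding T_def
    by (rule Bcontfun_inverse) (auto simp: bcontfun_def intro!: bounded_LP_map[OF adm m b] continuous_LP_map[OF adm _ b])
  have "\<exists>!y\<in>UNIV. T y = y"
  proof (rule Banach_fix[of UNIV "contraction L"])
    show "dist (T y) (T y') \<le> contraction L * dist y y'" for y y'
    proof (rule dist_bound)
      fix t
      have "norm (apply_bcontfun y \<sigma> - apply_bcontfun y' \<sigma>) \<le> dist y y'" for \<sigma>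
        using dist_bounded[of y \<sigma> y'] by (simp add: dist_norm)
      from LP_map_diff_le[OF adm m b m b this, of \<xi> t \<xi>]
      show "dist (apply_bcontfun (T y) t) (apply_bcontfun (T y') t) \<le> contraction L * dist y y'"
        by (simp add: T dist_norm)
    qed
  qed (simp_all only: complete_UNIV contraction_nonneg[OF admissibleD(3)[OF adm]] contr subset_UNIV UNIV_not_empty not_False_eq_True)
  then obtain y where y: "T y = y"
    by (elim ex1E conjE)
  have "apply_bcontfun y = LP_map g \<xi> y"
    using T[of y] unfolding y .
  then have eq: "apply_bcontfun y t = LP_map g \<xi> y t" for t
    by (rule fun_cong)
  have "LP_fixpoint g \<xi> (apply_bcontfun y)"
    unfolding LP_fixpoint_def
  proof (intro conjI allI)
    show "continuous_on UNIV (apply_bcontfun y)" "bounded (range (apply_bcontfun y))"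
      by (rule continuous_on_apply_bcontfun bounded_apply_bcontfun)+
    show "apply_bcontfun y t = LP_map g \<xi> y t" for t
      by (rule eq)
  qed
  from exI[where P = "LP_fixpoint g \<xi>", OF this] show ?thesis .
qed

definition LP_solution :: "(real \<Rightarrow> 'a \<Rightarrow> 'a) \<Rightarrow> 'a \<Rightarrow> real \<Rightarrow> 'a" where
  "LP_solution g \<xi> = (SOME y. LP_fixpoint g \<xi> y)"

definition graph_map :: "(real \<Rightarrow> 'a \<Rightarrow> 'a) \<Rightarrow> 'a \<Rightarrow> 'a" where
  "graph_map g \<xi> = LP_solution g \<xi> 0 - \<xi>"

lemma LP_solution:
  assumes "admissible L g" "contraction L < 1"
  shows "continuous_on UNIV (LP_solution g \<xi>)" "bounded (range (LP_solution g \<xi>))"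
    "LP_solution g \<xi> t = LP_map g \<xi> (LP_solution g \<xi>) t"
proof -
  have *: "LP_fixpoint g \<xi> (LP_solution g \<xi>)"
    unfolding LP_solution_def by (rule someI_ex[OF LP_fixpoint_exists[OF assms]])
  show "continuous_on UNIV (LP_solution g \<xi>)" "bounded (range (LP_solution g \<xi>))"
    "LP_solution g \<xi> t = LP_map g \<xi> (LP_solution g \<xi>) t"
    using * unfolding LP_fixpoint_def by blast+
qed

text \<open>The supremum \<open>d\<close> of the distance satisfies \<open>d \<le> K |\<xi> - \<xi>'| + \<kappa> d\<close> with \<open>\<kappa> < 1\<close> the contraction constant.
  For \<open>\<xi> = \<xi>'\<close> this is uniqueness.\<close>
lemma LP_fixpoints_dist:
  assumes adm: "admissible L g" and contr: "contraction L < 1"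
    and y: "continuous_on UNIV y" "bounded (y ` {..0})" "\<And>t. t \<le> 0 \<Longrightarrow> y t = LP_map g \<xi> y t"
    and y': "continuous_on UNIV y'" "bounded (y' ` {..0})" "\<And>t. t \<le> 0 \<Longrightarrow> y' t = LP_map g \<xi>' y' t"
  shows "norm (y 0 - y' 0) \<le> K / (1 - contraction L) * norm (\<xi> - \<xi>')"
proof -
  let ?d = "SUP \<sigma>\<in>{..0}. norm (y \<sigma> - y' \<sigma>)"
  from y(2) y'(2) obtain B B' where "\<And>\<sigma>. \<sigma> \<le> 0 \<Longrightarrow> norm (y \<sigma>) \<le> B" "\<And>\<sigma>. \<sigma> \<le> 0 \<Longrightarrow> norm (y' \<sigma>) \<le> B'"
    by (auto simp: bounded_iff)
  then have "norm (y \<sigma> - y' \<sigma>) \<le> B + B'" if "\<sigma> \<le> 0" for \<sigma>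
    using that norm_triangle_ineq4[of "y \<sigma>" "y' \<sigma>"] by (meson add_mono order_trans)
  then have "bdd_above ((\<lambda>\<sigma>. norm (y \<sigma> - y' \<sigma>)) ` {..0})"
    by (auto intro!: bdd_aboveI2)
  then have d: "norm (y \<sigma> - y' \<sigma>) \<le> ?d" if "\<sigma> \<le> 0" for \<sigma>
    using that by (intro cSUP_upper) auto
  have "?d \<le> K * norm (\<xi> - \<xi>') + contraction L * ?d"
  proof (rule cSUP_least)
    fix t :: real assume "t \<in> {..0}"
    then show "norm (y t - y' t) \<le> K * norm (\<xi> - \<xi>') + contraction L * ?d"
      using LP_map_diff_le[OF adm borel_measurable_continuous_onI[OF y(1)] y(2)
          borel_measurable_continuous_onI[OF y'(1)] y'(2) d, of \<xi> t \<xi>'] y(3) y'(3) by simp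
  qed simp
  then have "(1 - contraction L) * ?d \<le> K * norm (\<xi> - \<xi>')"
    by (simp add: algebra_simps)
  then have "?d \<le> K / (1 - contraction L) * norm (\<xi> - \<xi>')"
    using contr by (simp add: pos_le_divide_eq mult.commute)
  then show ?thesis
    using d[of 0] by simp
qed

lemma bounded_backward: "bounded (range f) \<Longrightarrow> bounded (f ` {..0 :: real})"
  by (rule bounded_subset) auto

lemma LP_solution_backward:
  assumes "admissible L g" "contraction L < 1"
  shows "bounded (LP_solution g \<xi> ` {..0})"
  by (rule bounded_backward[OF LP_solution(2)[OF assms]])

lemma graph_map_lipschitz:
  assumes "admissible L g" "contraction L < 1"
  shows "(K / (1 - contraction L) + 1)-lipschitz_on X (graph_map g)"
proof (rule lipschitz_onI)
  fix \<xi> \<xi>'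
  have "norm (LP_solution g \<xi> 0 - LP_solution g \<xi>' 0) \<le> K / (1 - contraction L) * norm (\<xi> - \<xi>')"
    by (intro LP_fixpoints_dist[OF assms] LP_solution[OF assms] LP_solution_backward[OF assms])
  moreover have "norm (graph_map g \<xi> - graph_map g \<xi>') \<le>
      norm (LP_solution g \<xi> 0 - LP_solution g \<xi>' 0) + norm (\<xi> - \<xi>')"
    using norm_triangle_ineq4[of "LP_solution g \<xi> 0 - LP_solution g \<xi>' 0" "\<xi> - \<xi>'"]
    by (simp add: graph_map_def algebra_simps)
  ultimately show "dist (graph_map g \<xi>) (graph_map g \<xi>') \<le> (K / (1 - contraction L) + 1) * dist \<xi> \<xi>'"
    by (simp add: dist_norm distrib_right)
qed (use assms K_nonneg in auto)

lemma graph_map_0: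
  assumes adm: "admissible L g" and contr: "contraction L < 1"
  shows "graph_map g 0 = 0"
proof -
  have "norm (LP_solution g 0 0 - 0) \<le> K / (1 - contraction L) * norm (0 - 0 :: 'a)"
    by (intro LP_fixpoints_dist[OF assms, where y' = "\<lambda>_. 0"] LP_solution[OF assms] LP_solution_backward[OF assms])
      (auto simp: LP_map_zero[OF adm] image_constant_conv)
  then show ?thesis
    by (simp add: graph_map_def)
qed

lemma LP_solution_Green:
  assumes "admissible L g" "contraction L < 1" "t \<le> 0"
  shows "LP_solution g \<xi> t = Ep t \<xi> + Green_int (\<lambda>\<sigma>. g \<sigma> (LP_solution g \<xi> \<sigma>)) t"
  using LP_solution(3)[OF assms(1,2), of \<xi> t] assms(3) by (simp add: LP_map_def)

lemma forcing_continuous_bounded: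
  assumes adm: "admissible L g" and y: "continuous_on UNIV y" "bounded (y ` {..0})"
  obtains M where "bounded_forcing M (\<lambda>\<sigma>. g \<sigma> (y \<sigma>))"
proof -
  from y(2) obtain B where "\<And>\<sigma>. \<sigma> \<le> 0 \<Longrightarrow> norm (y \<sigma>) \<le> B"
    by (auto simp: bounded_iff)
  then have "bounded_forcing (L * B) (\<lambda>\<sigma>. g \<sigma> (y \<sigma>))"
    by (rule forcing_g[OF adm borel_measurable_continuous_onI[OF y(1)]])
  then show ?thesis ..
qed

text \<open>At time \<open>0\<close> the Green kernel sees the stable component only, since all \<open>\<sigma> \<le> 0\<close> lie in its past; hence
  the unstable component of \<open>y 0\<close> is \<open>\<xi>\<close> itself.\<close>
lemma graph_map_stable:
  assumes adm: "admissible L g" and contr: "contraction L < 1" and \<xi>: "P \<xi> = \<xi>"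
  shows "P (graph_map g \<xi>) = 0"
proof -
  obtain M where "bounded_forcing M (\<lambda>\<sigma>. g \<sigma> (LP_solution g \<xi> \<sigma>))"
    using forcing_continuous_bounded[OF adm LP_solution(1) LP_solution_backward] assms(1,2) by blast
  then show ?thesis
    using LP_solution_Green[OF adm contr order_refl, of \<xi>] \<xi> by (simp add: graph_map_def P_Green_int_0 Ep_0)
qed

definition bounded_backward_orbits :: "(real \<Rightarrow> 'a \<Rightarrow> 'a) \<Rightarrow> 'a set" where
  "bounded_backward_orbits g = {x. \<exists>y. continuous_on UNIV y \<and> bounded (y ` {..0}) \<and> y 0 = x \<and>
     (\<forall>s t. s \<le> t \<longrightarrow> t \<le> 0 \<longrightarrow> mild_step S (\<lambda>\<sigma>. g \<sigma> (y \<sigma>)) y s t)}"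

lemma bounded_backward_orbits_eq_graph:
  assumes adm: "admissible L g" and contr: "contraction L < 1"
  shows "bounded_backward_orbits g = {\<xi> + graph_map g \<xi> | \<xi>. \<xi> \<in> range P}"
proof (intro set_eqI iffI)
  fix x assume "x \<in> bounded_backward_orbits g"
  then obtain y where y: "continuous_on UNIV y" "bounded (y ` {..0})" "y 0 = x"
    "\<And>s t. s \<le> t \<Longrightarrow> t \<le> 0 \<Longrightarrow> mild_step S (\<lambda>\<sigma>. g \<sigma> (y \<sigma>)) y s t"
    by (auto simp: bounded_backward_orbits_def)
  obtain M where "bounded_forcing M (\<lambda>\<sigma>. g \<sigma> (y \<sigma>))"
    using forcing_continuous_bounded[OF adm y(1,2)] .
  from bounded_mild_imp_Green[OF y(2) this continuous_on_g[OF adm y(1)] y(4)]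
  have "y t = LP_map g (P x) y t" if "t \<le> 0" for t
    using that y(3) by (simp add: LP_map_def)
  then have "norm (y 0 - LP_solution g (P x) 0) \<le> K / (1 - contraction L) * norm (P x - P x)"
    by (intro LP_fixpoints_dist[OF assms] LP_solution[OF assms] LP_solution_backward[OF assms] y)
  then have "x = P x + graph_map g (P x)"
    using y(3) by (simp add: graph_map_def)
  then show "x \<in> {\<xi> + graph_map g \<xi> | \<xi>. \<xi> \<in> range P}"
    by blast
next
  fix x assume "x \<in> {\<xi> + graph_map g \<xi> | \<xi>. \<xi> \<in> range P}"
  then obtain \<xi> where x: "x = LP_solution g \<xi> 0"
    by (auto simp: graph_map_def)
  let ?y = "LP_solution g \<xi>"
  have y: "continuous_on UNIV ?y" "bounded (?y ` {..0})"
    by (rule LP_solution(1)[OF assms], rule LP_solution_backward[OF assms])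
  obtain M where "bounded_forcing M (\<lambda>\<sigma>. g \<sigma> (?y \<sigma>))"
    using forcing_continuous_bounded[OF adm y] .
  then have "mild_step S (\<lambda>\<sigma>. g \<sigma> (?y \<sigma>)) ?y s t" if "s \<le> t" "t \<le> 0" for s t
    using that LP_solution_Green[OF assms] by (intro Green_imp_mild continuous_on_g[OF adm y(1)])
  then show "x \<in> bounded_backward_orbits g"
    using x y by (auto simp: bounded_backward_orbits_def)
qed

lemma lipschitz_graph_bounded_backward_orbits:
  assumes adm: "admissible L g" and contr: "contraction L < 1"
  shows "lipschitz_graph (range P) (range (\<lambda>x. x - P x)) (graph_map g) (bounded_backward_orbits g)"
proof -
  have "graph_map g \<xi> \<in> range (\<lambda>x. x - P x)" if "\<xi> \<in> range P" for \<xi>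
    using graph_map_stable[OF assms, of \<xi>] that by (intro range_eqI[of _ _ "graph_map g \<xi>"]) (simp add: in_range_P)
  then show ?thesis
    using graph_map_lipschitz[OF assms] bounded_backward_orbits_eq_graph[OF assms]
    by (auto simp: lipschitz_graph_def)
qed

section \<open>Measurable dependence on the path\<close>

text \<open>The solution is defined by choice, separately for each path; the iterates provide a description
  from which measurability in the path can be read off.\<close>
definition picard :: "(real \<Rightarrow> 'a \<Rightarrow> 'a) \<Rightarrow> 'a \<Rightarrow> nat \<Rightarrow> real \<Rightarrow> 'a" where
  "picard g \<xi> n = (LP_map g \<xi> ^^ n) (\<lambda>_. 0)"

lemma picard_simps: "picard g \<xi> 0 t = 0" "picard g \<xi> (Suc n) t = LP_map g \<xi> (picard g \<xi> n) t"
  by (simp_all add: picard_def)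

lemma picard_continuous_bounded:
  assumes "admissible L g"
  shows "continuous_on UNIV (picard g \<xi> n) \<and> bounded (range (picard g \<xi> n))"
proof (induction n)
  case 0
  then show ?case by (simp add: picard_def)
next
  case (Suc n)
  note y = conjunct1[OF Suc] bounded_backward[OF conjunct2[OF Suc]]
  have "picard g \<xi> (Suc n) = LP_map g \<xi> (picard g \<xi> n)"
    by (rule ext) (rule picard_simps(2))
  then show ?case
    by (simp only: continuous_LP_map[OF assms y] bounded_LP_map[OF assms borel_measurable_continuous_onI[OF y(1)] y(2)] simp_thms)
qed

lemma picard_tendsto:
  assumes adm: "admissible L g" and contr: "contraction L < 1"
  shows "(\<lambda>n. picard g \<xi> n t) \<longlonglongrightarrow> LP_solution g \<xi> t"
proof -
  let ?c = "contraction L"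
  obtain B where B: "\<And>t. norm (LP_solution g \<xi> t) \<le> B"
    using LP_solution(2)[OF assms, of \<xi>] by (auto simp: bounded_iff)
  have "norm (picard g \<xi> n t - LP_solution g \<xi> t) \<le> ?c ^ n * B" for n t
  proof (induction n arbitrary: t)
    case 0
    then show ?case using B by (simp add: picard_simps)
  next
    case (Suc n)
    have "norm (LP_map g \<xi> (picard g \<xi> n) t - LP_map g \<xi> (LP_solution g \<xi>) t) \<le>
        K * norm (\<xi> - \<xi>) + ?c * (?c ^ n * B)"
      using picard_continuous_bounded[OF adm, of \<xi> n]
      by (intro LP_map_diff_le[OF adm] borel_measurable_continuous_onI bounded_backward Suc
          LP_solution[OF assms] LP_solution_backward[OF assms]) auto
    then show ?case
      by (simp add: picard_simps flip: LP_solution(3)[OF assms])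
  qed
  then have "\<forall>\<^sub>F n in sequentially. norm (picard g \<xi> n t - LP_solution g \<xi> t) \<le> ?c ^ n * B"
    by (intro always_eventually allI)
  moreover have "(\<lambda>n. ?c ^ n * B) \<longlonglongrightarrow> 0"
    by (rule tendsto_mult_left_zero[OF LIMSEQ_realpow_zero[OF contraction_nonneg[OF admissibleD(3)[OF adm]] contr]])
  ultimately have "(\<lambda>n. picard g \<xi> n t - LP_solution g \<xi> t) \<longlonglongrightarrow> 0"
    by (rule Lim_null_comparison)
  then show ?thesis
    by (rule LIM_zero_cancel[of "\<lambda>n. picard g \<xi> n t"])
qed

text \<open>The iteration needs values of the previous iterate at all times, so the induction is carried out for
  joint measurability in time and path; the integral in \<open>Green_int\<close> preserves it by Fubini's theorem.\<close>
lemma measurable_picard: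
  fixes g :: "'w \<Rightarrow> real \<Rightarrow> 'a \<Rightarrow> 'a"
  assumes g: "\<And>y. y \<in> borel_measurable (borel \<Otimes>\<^sub>M N) \<Longrightarrow>
      (\<lambda>p. g (snd p) (fst p) (y p)) \<in> borel_measurable (borel \<Otimes>\<^sub>M N)"
  shows "(\<lambda>p. picard (g (snd p)) \<xi> n (fst p)) \<in> borel_measurable (borel \<Otimes>\<^sub>M N)"
proof (induction n)
  case 0
  then show ?case by (simp add: picard_simps)
next
  case (Suc n)
  have "(\<lambda>q. (snd q, snd (fst q))) \<in> (borel \<Otimes>\<^sub>M N) \<Otimes>\<^sub>M lborel \<rightarrow>\<^sub>M (borel \<Otimes>\<^sub>M N :: (real \<times> 'w) measure)"
    by measurable
  from measurable_compose[OF this g[OF Suc]]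
  have [measurable]: "(\<lambda>q. g (snd (fst q)) (snd q) (picard (g (snd (fst q))) \<xi> n (snd q)))
      \<in> borel_measurable ((borel \<Otimes>\<^sub>M N) \<Otimes>\<^sub>M lborel)"
    by simp
  have "(\<lambda>p. Green_int (\<lambda>\<sigma>. g (snd p) \<sigma> (picard (g (snd p)) \<xi> n \<sigma>)) (min (fst p) 0)) \<in> borel_measurable (borel \<Otimes>\<^sub>M N)"
    unfolding Green_int_def
  proof (rule lborel.borel_measurable_lebesgue_integral)
    show "(\<lambda>(p, \<sigma>). indicator {..0} \<sigma> *\<^sub>R Green (min (fst p) 0 - \<sigma>) (g (snd p) \<sigma> (picard (g (snd p)) \<xi> n \<sigma>)))
        \<in> borel_measurable ((borel \<Otimes>\<^sub>M N) \<Otimes>\<^sub>M lborel)"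
      unfolding split_beta by measurable
  qed
  moreover have "(\<lambda>p::real \<times> 'w. Ep (min (fst p) 0) \<xi>) \<in> borel_measurable (borel \<Otimes>\<^sub>M N)"
    by (rule measurable_compose[OF measurable_fst borel_measurable_continuous_onI])
      (intro continuous_on_Ep continuous_intros)
  ultimately show ?case
    unfolding picard_simps LP_map_def by (intro borel_measurable_add)
qed

lemma measurable_graph_map:
  fixes g :: "'w \<Rightarrow> real \<Rightarrow> 'a \<Rightarrow> 'a"
  assumes g: "\<And>y. y \<in> borel_measurable (borel \<Otimes>\<^sub>M N) \<Longrightarrow>
      (\<lambda>p. g (snd p) (fst p) (y p)) \<in> borel_measurable (borel \<Otimes>\<^sub>M N)"
    and adm: "\<And>\<omega>. \<omega> \<in> space N \<Longrightarrow> admissible L (g \<omega>)" and contr: "contraction L < 1"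
  shows "(\<lambda>\<omega>. graph_map (g \<omega>) \<xi>) \<in> borel_measurable N"
proof -
  have "(\<lambda>\<omega>. picard (g \<omega>) \<xi> n 0) \<in> borel_measurable N" for n
  proof -
    have "Pair (0 :: real) \<in> N \<rightarrow>\<^sub>M borel \<Otimes>\<^sub>M N"
      by (rule measurable_Pair1') simp
    from measurable_compose[OF this measurable_picard[where g = g and \<xi> = \<xi> and n = n, OF g]] show ?thesis
      by simp
  qed
  then have "(\<lambda>\<omega>. LP_solution (g \<omega>) \<xi> 0) \<in> borel_measurable N"
    by (rule borel_measurable_LIMSEQ_metric) (rule picard_tendsto[OF adm contr])
  then show ?thesis
    unfolding graph_map_def by measurable
qed

end

section \<open>Lipschitz graphs over the range of a projection\<close>

text \<open>The graph is the image of the whole space under \<open>d \<mapsto> P d + h (P d)\<close>, whence the density; it is also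
  the set of fixed points of this continuous map, whence it is closed.\<close>
lemma closure_graph:
  fixes P h :: "'a::real_normed_vector \<Rightarrow> 'a"
  assumes P: "bounded_linear P" "\<And>x. P (P x) = P x"
    and h: "C-lipschitz_on (range P) h" "h ` range P \<subseteq> range (\<lambda>x. x - P x)"
    and D: "closure D = UNIV"
  shows "closure ((\<lambda>d. P d + h (P d)) ` D) = {\<xi> + h \<xi> | \<xi>. \<xi> \<in> range P}"
proof -
  let ?\<phi> = "\<lambda>d. P d + h (P d)"
  have contP: "continuous_on UNIV P"
    by (rule linear_continuous_on[OF P(1)])
  have cont: "continuous_on UNIV ?\<phi>"
    using continuous_on_compose2[OF lipschitz_on_continuous_on[OF h(1)] contP]
    by (intro continuous_on_add contP) auto
  have M: "{\<xi> + h \<xi> | \<xi>. \<xi> \<in> range P} = range ?\<phi>"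
    by (auto simp: P(2))
  have "P (?\<phi> d) = P d" for d
  proof -
    obtain x where "h (P d) = x - P x"
      using h(2) by blast
    then show ?thesis
      by (simp add: linear_simps[OF P(1)] P(2))
  qed
  then have "range ?\<phi> = {x. x = ?\<phi> x}"
    by force
  then have "closed (range ?\<phi>)"
    using closed_Collect_eq[OF continuous_on_id cont] by simp
  then have "closure (?\<phi> ` D) \<subseteq> range ?\<phi>"
    by (intro closure_minimal) auto
  moreover have "?\<phi> ` closure D \<subseteq> closure (?\<phi> ` D)"
    using cont D by (intro image_closure_subset) (auto intro: closure_subset[THEN subsetD])
  ultimately show ?thesis
    using M D by auto
qed

lemma lipschitz_graph_scaleR:
  fixes h :: "'a::real_normed_vector \<Rightarrow> 'a"
  assumes graph: "lipschitz_graph Hp Hm h M" and c: "c > 0"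
    and cone: "\<And>k x. x \<in> Hp \<Longrightarrow> k *\<^sub>R x \<in> Hp" "\<And>k x. x \<in> Hm \<Longrightarrow> k *\<^sub>R x \<in> Hm"
  shows "lipschitz_graph Hp Hm (\<lambda>\<xi>. c *\<^sub>R h (inverse c *\<^sub>R \<xi>)) ((*\<^sub>R) c ` M)"
  unfolding lipschitz_graph_def
proof (intro conjI)
  note g = graph[unfolded lipschitz_graph_def]
  show "(\<lambda>\<xi>. c *\<^sub>R h (inverse c *\<^sub>R \<xi>)) ` Hp \<subseteq> Hm"
    using g cone by blast
  from g obtain L where L: "L-lipschitz_on Hp h"
    by blast
  have "L-lipschitz_on Hp (\<lambda>\<xi>. c *\<^sub>R h (inverse c *\<^sub>R \<xi>))"
  proof (rule lipschitz_onI)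
    fix x y assume xy: "x \<in> Hp" "y \<in> Hp"
    have "dist (c *\<^sub>R h (inverse c *\<^sub>R x)) (c *\<^sub>R h (inverse c *\<^sub>R y)) =
        c * dist (h (inverse c *\<^sub>R x)) (h (inverse c *\<^sub>R y))"
      unfolding dist_norm scaleR_diff_right[symmetric] norm_scaleR using c by simp
    also have "\<dots> \<le> c * (L * dist (inverse c *\<^sub>R x) (inverse c *\<^sub>R y))"
      using c xy cone by (intro mult_left_mono lipschitz_onD[OF L]) auto
    also have "\<dots> = L * dist x y"
      unfolding dist_norm scaleR_diff_right[symmetric] norm_scaleR using c by simp
    finally show "dist (c *\<^sub>R h (inverse c *\<^sub>R x)) (c *\<^sub>R h (inverse c *\<^sub>R y)) \<le> L * dist x y" .
  qed (rule lipschitz_on_nonneg[OF L])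
  then show "\<exists>L. L-lipschitz_on Hp (\<lambda>\<xi>. c *\<^sub>R h (inverse c *\<^sub>R \<xi>))" ..
  show "(*\<^sub>R) c ` M = {\<xi> + c *\<^sub>R h (inverse c *\<^sub>R \<xi>) | \<xi>. \<xi> \<in> Hp}"
  proof (intro set_eqI iffI)
    fix x assume "x \<in> (*\<^sub>R) c ` M"
    then obtain \<xi> where "\<xi> \<in> Hp" "x = c *\<^sub>R (\<xi> + h \<xi>)"
      using g by blast
    then show "x \<in> {\<xi> + c *\<^sub>R h (inverse c *\<^sub>R \<xi>) | \<xi>. \<xi> \<in> Hp}"
      using c cone by (intro CollectI exI[of _ "c *\<^sub>R \<xi>"]) (auto simp: scaleR_add_right)
  next
    fix x assume "x \<in> {\<xi> + c *\<^sub>R h (inverse c *\<^sub>R \<xi>) | \<xi>. \<xi> \<in> Hp}"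
    then obtain \<xi> where \<xi>: "\<xi> \<in> Hp" "x = \<xi> + c *\<^sub>R h (inverse c *\<^sub>R \<xi>)"
      by blast
    then have "x = c *\<^sub>R (inverse c *\<^sub>R \<xi> + h (inverse c *\<^sub>R \<xi>))"
      using c by (simp add: scaleR_add_right)
    moreover have "inverse c *\<^sub>R \<xi> + h (inverse c *\<^sub>R \<xi>) \<in> M"
      using g \<xi> cone by blast
    ultimately show "x \<in> (*\<^sub>R) c ` M"
      by blast
  qed
qed

section \<open>The noise\<close>

lemma shift_shift: "shift t (shift s \<omega>) = shift (s + t) \<omega>"
  by (simp add: shift_def fun_eq_iff add_ac)

text \<open>Evaluation at \<open>t\<close> is continuous for the compact-open topology: take the compact set \<open>{t}\<close>.\<close>
lemma measurable_evaluation: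
  assumes "wiener_measure W"
  shows "(\<lambda>\<omega>. \<omega> t) \<in> borel_measurable W"
proof (rule borel_measurableI)
  fix U :: "real set" assume "open U"
  have W: "space W = C0" "sets W = sigma_sets C0 {V. openin compact_open_topology V}"
    using assms by (auto simp: wiener_measure_def)
  have "openin compact_open_topology {\<omega> \<in> C0. \<omega> ` {t} \<subseteq> U}"
    unfolding compact_open_topology_def
    using \<open>open U\<close> by (intro topology_generated_by_Basis CollectI exI[of _ "{t}"] exI[of _ U]) auto
  moreover have "(\<lambda>\<omega>. \<omega> t) -` U \<inter> space W = {\<omega> \<in> C0. \<omega> ` {t} \<subseteq> U}"
    by (auto simp: W)
  ultimately show "(\<lambda>\<omega>. \<omega> t) -` U \<inter> space W \<in> sets W"
    by (auto simp: W)
qed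

lemma measurable_z_shift:
  assumes W: "wiener_measure W"
  shows "(\<lambda>\<omega>. z_OU (shift s \<omega>)) \<in> borel_measurable W"
proof -
  have ev: "(\<lambda>p. (snd p) (fst p)) \<in> borel_measurable (borel \<Otimes>\<^sub>M W)"
  proof (rule measurable_Caratheodory[of "\<lambda>t \<omega>. \<omega> t"])
    fix \<omega> assume "\<omega> \<in> space W"
    then show "continuous_on UNIV (\<lambda>t. \<omega> t)"
      using W by (simp add: wiener_measure_def C0_def)
  qed (rule measurable_evaluation[OF W])
  have "(\<lambda>p. (snd p + s, fst p)) \<in> W \<Otimes>\<^sub>M lborel \<rightarrow>\<^sub>M (borel \<Otimes>\<^sub>M W)"
    by measurable
  from measurable_compose[OF this ev] have [measurable]: "(\<lambda>p. (fst p) (snd p + s)) \<in> borel_measurable (W \<Otimes>\<^sub>M lborel)"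
    by simp
  have [measurable]: "(\<lambda>\<omega>. \<omega> s) \<in> borel_measurable W"
    by (rule measurable_evaluation[OF W])
  have "(\<lambda>\<omega>. \<integral>\<tau>. indicator {..0} \<tau> *\<^sub>R (exp \<tau> * (\<omega> (\<tau> + s) - \<omega> s)) \<partial>lborel) \<in> borel_measurable W"
    by (rule lborel.borel_measurable_lebesgue_integral) (unfold split_beta, measurable)
  then show ?thesis
    unfolding z_OU_def set_lebesgue_integral_def shift_def by measurable
qed

section \<open>The random equation in rescaled coordinates\<close>

locale random_equation =
  fixes S :: "real \<Rightarrow> 'a::{banach, second_countable_topology} \<Rightarrow> 'a"
    and P F :: "'a \<Rightarrow> 'a" and \<alpha> \<beta> K LipF \<eta> :: real
    and W :: "(real \<Rightarrow> real) measure" and \<Omega> :: "(real \<Rightarrow> real) set"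
  assumes semigroup: "strongly_continuous_semigroup S"
    and dichotomy: "exponential_dichotomy S P \<alpha> \<beta> K"
    and K_nonneg: "0 \<le> K"
    and F_0: "F 0 = 0"
    and LipF_nonneg: "0 \<le> LipF"
    and F_P: "norm (P (F x1 - F x2)) \<le> LipF * norm (x1 - x2)"
    and F_Q: "norm ((F x1 - F x2) - P (F x1 - F x2)) \<le> LipF * norm (x1 - x2)"
    and wiener: "wiener_measure W"
    and paths: "noise_paths W \<Omega>"
    and eta: "\<beta> < \<eta>" "\<eta> < \<alpha>"
    and gap: "K * LipF * (1 / (\<eta> - \<beta>) + 1 / (\<alpha> - \<eta>)) < 1"
begin

definition S_resc :: "real \<Rightarrow> 'a \<Rightarrow> 'a" where
  "S_resc t x = exp (- \<eta> * t) *\<^sub>R S t x"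

sublocale dichotomy S_resc P "\<alpha> - \<eta>" "\<beta> - \<eta>" K
proof
  have "S_resc = (\<lambda>t x. exp (- \<eta> * t) *\<^sub>R S t x)"
    by (simp add: S_resc_def fun_eq_iff)
  then show "strongly_continuous_semigroup S_resc" "exponential_dichotomy S_resc P (\<alpha> - \<eta>) (\<beta> - \<eta>) K"
    using strongly_continuous_semigroup_rescale[OF semigroup, of \<eta>]
      exponential_dichotomy_rescale[OF dichotomy semigroup, of \<eta>] by simp_all
qed (use K_nonneg eta in auto)

text \<open>The exponent of the change of variables \<open>v t = exp (drift \<omega> t) y t\<close>; the term \<open>\<eta> t\<close> carries the weight
  of \<open>C\<^sub>\<eta>\<^sup>-\<close>.\<close>
definition drift :: "(real \<Rightarrow> real) \<Rightarrow> real \<Rightarrow> real" where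
  "drift \<omega> t = (LBINT r=0..t. z_OU (shift r \<omega>)) + \<eta> * t"

text \<open>The nonlinearity \<open>exp (- drift \<omega> \<sigma>) G(\<theta>\<^sub>\<sigma> \<omega>, exp (drift \<omega> \<sigma>) x)\<close> of the transformed equation: the
  factors \<open>exp (\<plusminus> z)\<close> in \<open>G\<close> and those of the change of variables combine into one exponent.\<close>
definition nonlin :: "(real \<Rightarrow> real) \<Rightarrow> real \<Rightarrow> 'a \<Rightarrow> 'a" where
  "nonlin \<omega> \<sigma> x = (let c = z_OU (shift \<sigma> \<omega>) + drift \<omega> \<sigma> in exp (- c) *\<^sub>R F (exp c *\<^sub>R x))"

lemma contraction_less_1: "contraction LipF < 1"
proof -
  have "1 / (\<beta> - \<eta>) = - (1 / (\<eta> - \<beta>))"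
    using eta by (simp add: divide_simps)
  then show ?thesis
    using gap by (simp add: contraction_def add.commute)
qed

lemma shift_in: "\<omega> \<in> \<Omega> \<Longrightarrow> shift t \<omega> \<in> \<Omega>"
  using paths by (auto simp: noise_paths_def)

lemma continuous_z: "\<omega> \<in> \<Omega> \<Longrightarrow> continuous_on UNIV (\<lambda>t. z_OU (shift t \<omega>))"
  using paths by (auto simp: noise_paths_def)

lemma continuous_drift: "\<omega> \<in> \<Omega> \<Longrightarrow> continuous_on UNIV (drift \<omega>)"
  unfolding drift_def by (intro continuous_intros continuous_on_integral_from_0 continuous_z)

lemma drift_0 [simp]: "drift \<omega> 0 = 0"
  by (simp add: drift_def zero_ereal_def[symmetric])

text \<open>The drift is a cocycle, so the transformed equations for \<open>\<omega>\<close> and \<open>shift t \<omega>\<close> are conjugate by the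
  constant factor \<open>exp (drift \<omega> t)\<close>.\<close>
lemma drift_shift:
  assumes "\<omega> \<in> \<Omega>"
  shows "drift (shift t \<omega>) s = drift \<omega> (s + t) - drift \<omega> t"
proof -
  have z: "continuous_on UNIV (\<lambda>r. z_OU (shift (t + r) \<omega>))"
    by (rule continuous_on_compose2[OF continuous_z[OF assms]]) (auto intro!: continuous_intros)
  have *: "(LBINT r=0..s. z_OU (shift (r + t) \<omega>)) = (LBINT r=t..s + t. z_OU (shift r \<omega>))"
  proof (cases "0 \<le> s")
    case True
    then show ?thesis
      using interval_integral_shift[of 0 s "\<lambda>r. z_OU (shift r \<omega>)" t] by (simp add: zero_ereal_def)
  next
    case False
    then have "(LBINT r=s..0. z_OU (shift (r + t) \<omega>)) = (LBINT r=s + t..t. z_OU (shift r \<omega>))"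
      using interval_integral_shift[of s 0 "\<lambda>r. z_OU (shift r \<omega>)" t] by (simp add: zero_ereal_def)
    then show ?thesis
      by (metis interval_integral_endpoints_reverse)
  qed
  show ?thesis
    unfolding drift_def shift_shift add.commute[of t] * integral_from_0_diff[OF continuous_z[OF assms]]
    by (simp add: algebra_simps)
qed

lemma continuous_F: "continuous_on UNIV F"
proof (rule lipschitz_on_continuous_on[of "2 * LipF"])
  show "(2 * LipF)-lipschitz_on UNIV F"
  proof (rule lipschitz_onI)
    fix x y
    have "norm (F x - F y) \<le> norm (P (F x - F y)) + norm ((F x - F y) - P (F x - F y))"
      using norm_triangle_ineq[of "P (F x - F y)" "(F x - F y) - P (F x - F y)"] by (simp only: add_diff_cancel_left' diff_add_cancel add.commute[of _ "_ - _"])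
    also have "\<dots> \<le> LipF * norm (x - y) + LipF * norm (x - y)"
      by (intro add_mono F_P F_Q)
    finally show "dist (F x) (F y) \<le> 2 * LipF * dist x y"
      by (simp add: dist_norm)
  qed (use LipF_nonneg in simp)
qed

lemma admissible_nonlin:
  assumes "\<omega> \<in> \<Omega>"
  shows "admissible LipF (nonlin \<omega>)"
  unfolding admissible_def
proof (intro conjI allI)
  have c: "continuous_on UNIV (\<lambda>\<sigma>. z_OU (shift \<sigma> \<omega>) + drift \<omega> \<sigma>)"
    by (intro continuous_on_add continuous_z continuous_drift assms)
  have "continuous_on UNIV (\<lambda>p::real \<times> 'a. z_OU (shift (fst p) \<omega>) + drift \<omega> (fst p))"
    by (rule continuous_on_compose2[OF c continuous_on_fst]) (auto intro: continuous_on_id)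
  then show "continuous_on UNIV (\<lambda>p. nonlin \<omega> (fst p) (snd p))"
    unfolding nonlin_def Let_def
    by (intro continuous_on_scaleR continuous_on_compose2[OF continuous_F] continuous_on_exp continuous_on_minus
        continuous_on_snd continuous_on_id subset_UNIV)
  fix \<sigma> x y
  show "nonlin \<omega> \<sigma> 0 = 0"
    by (simp add: nonlin_def F_0 Let_def)
  define c where "c = z_OU (shift \<sigma> \<omega>) + drift \<omega> \<sigma>"
  have diff: "nonlin \<omega> \<sigma> x - nonlin \<omega> \<sigma> y = exp (- c) *\<^sub>R (F (exp c *\<^sub>R x) - F (exp c *\<^sub>R y))"
    by (simp add: nonlin_def c_def Let_def scaleR_diff_right)
  have eq: "exp (- c) * (LipF * norm (exp c *\<^sub>R x - exp c *\<^sub>R y)) = LipF * norm (x - y)"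
    by (simp add: exp_minus flip: scaleR_diff_right)
  have "norm (P (nonlin \<omega> \<sigma> x - nonlin \<omega> \<sigma> y)) = exp (- c) * norm (P (F (exp c *\<^sub>R x) - F (exp c *\<^sub>R y)))"
    unfolding diff P_simps(5) by simp
  also have "\<dots> \<le> exp (- c) * (LipF * norm (exp c *\<^sub>R x - exp c *\<^sub>R y))"
    by (intro mult_left_mono F_P) simp
  finally show "norm (P (nonlin \<omega> \<sigma> x - nonlin \<omega> \<sigma> y)) \<le> LipF * norm (x - y)"
    by (simp only: eq)
  have "norm ((nonlin \<omega> \<sigma> x - nonlin \<omega> \<sigma> y) - P (nonlin \<omega> \<sigma> x - nonlin \<omega> \<sigma> y)) =
      exp (- c) * norm ((F (exp c *\<^sub>R x) - F (exp c *\<^sub>R y)) - P (F (exp c *\<^sub>R x) - F (exp c *\<^sub>R y)))"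
    unfolding diff P_simps(5) scaleR_diff_right[symmetric] by simp
  also have "\<dots> \<le> exp (- c) * (LipF * norm (exp c *\<^sub>R x - exp c *\<^sub>R y))"
    by (intro mult_left_mono F_Q) simp
  finally show "norm ((nonlin \<omega> \<sigma> x - nonlin \<omega> \<sigma> y) - P (nonlin \<omega> \<sigma> x - nonlin \<omega> \<sigma> y)) \<le> LipF * norm (x - y)"
    by (simp only: eq)
qed (rule LipF_nonneg)

text \<open>The two equations differ by the factor \<open>exp (drift \<omega> t)\<close>, which is constant in the integration
  variable \<open>\<sigma>\<close>.\<close>
lemma mild_solution_rescale:
  assumes \<omega>: "\<omega> \<in> \<Omega>" and st: "s \<le> t"
    and v: "\<And>\<sigma>. s \<le> \<sigma> \<Longrightarrow> \<sigma> \<le> t \<Longrightarrow> v \<sigma> = exp (drift \<omega> \<sigma>) *\<^sub>R y \<sigma>"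
  shows "v t = evol S \<omega> s t (v s) + (LBINT \<sigma>=s..t. evol S \<omega> \<sigma> t (G_rand F (shift \<sigma> \<omega>) (v \<sigma>))) \<longleftrightarrow>
    mild_step S_resc (\<lambda>\<sigma>. nonlin \<omega> \<sigma> (y \<sigma>)) y s t"
proof -
  have evol: "evol S \<omega> \<sigma> t (exp (drift \<omega> \<sigma>) *\<^sub>R x) = exp (drift \<omega> t) *\<^sub>R S_resc (t - \<sigma>) x"
    if "\<sigma> \<le> t" for \<sigma> x
  proof -
    interpret L: bounded_linear "S (t - \<sigma>)"
      using semigroup that by (simp add: strongly_continuous_semigroup_def)
    have "(LBINT r=\<sigma>..t. z_OU (shift r \<omega>)) + drift \<omega> \<sigma> = drift \<omega> t + (- \<eta> * (t - \<sigma>))"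
      unfolding drift_def integral_from_0_diff[OF continuous_z[OF \<omega>], of \<sigma> t] by (simp add: algebra_simps)
    then show ?thesis
      by (simp only: evol_def S_resc_def L.scaleR scaleR_scaleR exp_add[symmetric])
  qed
  have G: "G_rand F (shift \<sigma> \<omega>) (exp (drift \<omega> \<sigma>) *\<^sub>R x) = exp (drift \<omega> \<sigma>) *\<^sub>R nonlin \<omega> \<sigma> x" for \<sigma> x
    by (simp add: G_rand_def nonlin_def Let_def exp_add[symmetric])
  have "(LBINT \<sigma>=s..t. evol S \<omega> \<sigma> t (G_rand F (shift \<sigma> \<omega>) (v \<sigma>))) =
      (LBINT \<sigma>=s..t. exp (drift \<omega> t) *\<^sub>R S_resc (t - \<sigma>) (nonlin \<omega> \<sigma> (y \<sigma>)))"
    using st by (intro interval_integral_cong) (auto simp: einterval_iff v G evol)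
  also have "\<dots> = exp (drift \<omega> t) *\<^sub>R (LBINT \<sigma>=s..t. S_resc (t - \<sigma>) (nonlin \<omega> \<sigma> (y \<sigma>)))"
    by (rule interval_integral_scaleR)
  finally show ?thesis
    using st by (simp add: v evol mild_step_def flip: scaleR_add_right)
qed

lemma M_u_eq_bounded_backward_orbits:
  assumes \<omega>: "\<omega> \<in> \<Omega>"
  shows "M_u S F \<eta> \<omega> = bounded_backward_orbits (nonlin \<omega>)"
proof (intro set_eqI iffI)
  fix x assume "x \<in> M_u S F \<eta> \<omega>"
  then obtain v where v: "continuous_on {..0} v" "v 0 = x" "backward_mild_solution S F \<omega> v"
    and bdd: "bdd_above ((\<lambda>t. exp (- \<eta> * t - (LBINT \<tau>=0..t. z_OU (shift \<tau> \<omega>))) * norm (v t)) ` {..0})"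
    by (auto simp: M_u_def C_minus_def)
  \<comment> \<open>Elements of \<open>C\<^sub>\<eta>\<^sup>-\<close> are arbitrary at positive times and are replaced there by their value at \<open>0\<close>.\<close>
  define y where "y t = exp (- drift \<omega> (min t 0)) *\<^sub>R v (min t 0)" for t
  have vy: "v t = exp (drift \<omega> t) *\<^sub>R y t" if "t \<le> 0" for t
    using that by (simp add: y_def exp_add[symmetric])
  have "continuous_on UNIV y"
    unfolding y_def
    by (intro continuous_on_scaleR continuous_on_exp continuous_on_minus continuous_on_compose2[OF v(1)]
        continuous_on_compose2[OF continuous_drift[OF \<omega>]] continuous_intros) auto
  moreover have "bounded (y ` {..0})"
  proof -
    from bdd obtain B where B: "\<And>t. t \<le> 0 \<Longrightarrow> exp (- \<eta> * t - (LBINT \<tau>=0..t. z_OU (shift \<tau> \<omega>))) * norm (v t) \<le> B"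
      by (auto simp: bdd_above_def)
    have "norm (y t) \<le> B" if "t \<le> 0" for t
    proof -
      have "- \<eta> * t - (LBINT \<tau>=0..t. z_OU (shift \<tau> \<omega>)) = - drift \<omega> t"
        by (simp add: drift_def)
      then show ?thesis
        using B[OF that] that by (simp add: y_def)
    qed
    then show ?thesis
      by (auto simp: bounded_iff)
  qed
  moreover have "mild_step S_resc (\<lambda>\<sigma>. nonlin \<omega> \<sigma> (y \<sigma>)) y s t" if "s \<le> t" "t \<le> 0" for s t
    using v(3) that mild_solution_rescale[OF \<omega> that(1), of v y] vy
    by (auto simp: backward_mild_solution_def)
  ultimately show "x \<in> bounded_backward_orbits (nonlin \<omega>)"
    using vy[of 0] v(2) by (auto simp: bounded_backward_orbits_def)
next
  fix x assume "x \<in> bounded_backward_orbits (nonlin \<omega>)"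
  then obtain y where y: "continuous_on UNIV y" "bounded (y ` {..0})" "y 0 = x"
    "\<And>s t. s \<le> t \<Longrightarrow> t \<le> 0 \<Longrightarrow> mild_step S_resc (\<lambda>\<sigma>. nonlin \<omega> \<sigma> (y \<sigma>)) y s t"
    by (auto simp: bounded_backward_orbits_def)
  define v where "v t = exp (drift \<omega> t) *\<^sub>R y t" for t
  have "v \<in> C_minus \<eta> \<omega>"
    unfolding C_minus_def
  proof (intro CollectI conjI)
    show "continuous_on {..0} v"
      unfolding v_def
      by (intro continuous_on_scaleR continuous_on_exp continuous_on_subset[OF continuous_drift[OF \<omega>]]
          continuous_on_subset[OF y(1)]) auto
    from y(2) obtain B where "\<And>t. t \<le> 0 \<Longrightarrow> norm (y t) \<le> B"
      by (auto simp: bounded_iff)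
    moreover have "exp (- \<eta> * t - (LBINT \<tau>=0..t. z_OU (shift \<tau> \<omega>))) * norm (v t) = norm (y t)" for t
      by (simp add: v_def drift_def exp_add[symmetric] flip: mult.assoc)
    ultimately show "bdd_above ((\<lambda>t. exp (- \<eta> * t - (LBINT \<tau>=0..t. z_OU (shift \<tau> \<omega>))) * norm (v t)) ` {..0})"
      by (auto intro!: bdd_aboveI2)
  qed
  moreover have "backward_mild_solution S F \<omega> v"
    unfolding backward_mild_solution_def
    using mild_solution_rescale[OF \<omega>, of _ _ v y] y(4) v_def by blast
  ultimately show "x \<in> M_u S F \<eta> \<omega>"
    using y(3) by (auto simp: M_u_def v_def intro!: bexI[of _ v])
qed

lemma nonlin_shift:
  assumes "\<omega> \<in> \<Omega>"
  shows "nonlin (shift t \<omega>) \<sigma> (exp (drift \<omega> t) *\<^sub>R x) = exp (drift \<omega> t) *\<^sub>R nonlin \<omega> (\<sigma> + t) x"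
  by (simp add: nonlin_def Let_def shift_shift drift_shift[OF assms] add.commute[of t] exp_add[symmetric])

lemma mild_step_shift:
  assumes \<omega>: "\<omega> \<in> \<Omega>" and ab: "a \<le> b"
    and mild: "mild_step S_resc (\<lambda>\<sigma>. nonlin \<omega> \<sigma> (y \<sigma>)) y (a + t) (b + t)"
  defines "y' \<equiv> \<lambda>\<sigma>. exp (drift \<omega> t) *\<^sub>R y (\<sigma> + t)"
  shows "mild_step S_resc (\<lambda>\<sigma>. nonlin (shift t \<omega>) \<sigma> (y' \<sigma>)) y' a b"
proof -
  let ?e = "exp (drift \<omega> t)"
  interpret L: bounded_linear "S_resc (b - a)"
    using ab by (intro lin_S) simp
  have "(LBINT \<sigma>=a..b. S_resc (b - \<sigma>) (nonlin (shift t \<omega>) \<sigma> (y' \<sigma>))) =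
      (LBINT \<sigma>=a..b. ?e *\<^sub>R S_resc (b + t - (\<sigma> + t)) (nonlin \<omega> (\<sigma> + t) (y (\<sigma> + t))))"
    using ab by (intro interval_integral_cong) (auto simp: einterval_iff y'_def nonlin_shift[OF \<omega>] S_simps)
  also have "\<dots> = ?e *\<^sub>R (LBINT \<sigma>=a + t..b + t. S_resc (b + t - \<sigma>) (nonlin \<omega> \<sigma> (y \<sigma>)))"
    unfolding interval_integral_scaleR
      interval_integral_shift[OF ab, of "\<lambda>\<sigma>. S_resc (b + t - \<sigma>) (nonlin \<omega> \<sigma> (y \<sigma>))" t] ..
  finally show ?thesis
    using mild by (simp add: mild_step_def y'_def L.scaleR scaleR_add_right)
qed

text \<open>The glued function \<open>Y\<close> follows the bounded backward solution up to time \<open>0\<close> and the forward solution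
  afterwards. Seen from time \<open>T\<close> it is a backward solution for the shifted path, and the time
  interval from \<open>0\<close> to \<open>T\<close> that is added to its past is compact, so it stays bounded.\<close>
lemma M_u_invariant:
  assumes \<omega>: "\<omega> \<in> \<Omega>" and T: "0 \<le> T" and x: "x \<in> M_u S F \<eta> \<omega>"
    and w: "forward_mild_solution S F \<omega> x w"
  shows "w T \<in> M_u S F \<eta> (shift T \<omega>)"
proof -
  obtain y where y: "continuous_on UNIV y" "bounded (y ` {..0})" "y 0 = x"
    "\<And>s t. s \<le> t \<Longrightarrow> t \<le> 0 \<Longrightarrow> mild_step S_resc (\<lambda>\<sigma>. nonlin \<omega> \<sigma> (y \<sigma>)) y s t"
    using x by (auto simp: M_u_eq_bounded_backward_orbits[OF \<omega>] bounded_backward_orbits_def)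
  have w_cont: "continuous_on {0..} w"
    and w_mild: "\<And>t. t \<ge> 0 \<Longrightarrow> w t = evol S \<omega> 0 t x + (LBINT s=0..t. evol S \<omega> s t (G_rand F (shift s \<omega>) (w s)))"
    using w by (auto simp: forward_mild_solution_def)
  have "evol S \<omega> 0 0 x = x"
    using semigroup by (simp add: evol_def strongly_continuous_semigroup_def)
  then have w_0: "w 0 = x"
    using w_mild[of 0] by (simp flip: zero_ereal_def)
  define Y where "Y s = (if s \<le> 0 then y s else exp (- drift \<omega> s) *\<^sub>R w s)" for s
  let ?f = "\<lambda>\<sigma>. nonlin \<omega> \<sigma> (Y \<sigma>)"
  have Y_w: "w s = exp (drift \<omega> s) *\<^sub>R Y s" if "s \<ge> 0" for s
    using that y(3) w_0 by (cases "s = 0") (auto simp: Y_def exp_add[symmetric])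
  have "continuous_on ({..0} \<union> {0..}) (\<lambda>s. if s \<le> 0 then y s else exp (- drift \<omega> s) *\<^sub>R w s)"
    using y(3) w_0
    by (intro continuous_on_If continuous_on_scaleR continuous_on_exp continuous_on_minus w_cont
        continuous_on_subset[OF y(1)] continuous_on_subset[OF continuous_drift[OF \<omega>]]) auto
  moreover have "{..0} \<union> {0..} = (UNIV :: real set)"
    by auto
  ultimately have Y_cont: "continuous_on UNIV Y"
    by (simp add: Y_def)
  have f_cont: "continuous_on UNIV ?f"
    by (rule continuous_on_g[OF admissible_nonlin[OF \<omega>] Y_cont])
  have past: "mild_step S_resc ?f Y s t" if "s \<le> t" "t \<le> 0" for s t
    using y(4)[OF that] that by (subst mild_step_cong[where y' = y and f' = "\<lambda>\<sigma>. nonlin \<omega> \<sigma> (y \<sigma>)"]) (auto simp: Y_def)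
  have future: "mild_step S_resc ?f Y 0 t" if "t \<ge> 0" for t
    using mild_solution_rescale[OF \<omega> that, of w Y] w_mild[OF that] Y_w w_0 by (simp add: zero_ereal_def)
  have mild: "mild_step S_resc ?f Y s t" if "s \<le> t" for s t
  proof -
    consider "t \<le> 0" | "0 \<le> s" | "s \<le> 0" "0 \<le> t"
      by linarith
    then show ?thesis
    proof cases
      case 1
      then show ?thesis
        by (rule past[OF that])
    next
      case 2
      then show ?thesis
        using mild_step_concat[OF 2 that f_cont future[OF 2]] future[of t] that by simp
    next
      case 3
      then show ?thesis
        using mild_step_concat[OF 3 f_cont past[OF 3(1) order_refl]] future[of t] by simp
    qed
  qed
  define y' where "y' = (\<lambda>\<sigma>. exp (drift \<omega> T) *\<^sub>R Y (\<sigma> + T))"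
  have "continuous_on UNIV y'"
    unfolding y'_def by (intro continuous_intros continuous_on_compose2[OF Y_cont]) auto
  moreover have "bounded (y' ` {..0})"
  proof -
    have "bounded (Y ` {..0} \<union> Y ` {0..T})"
      unfolding bounded_Un
    proof
      show "bounded (Y ` {..0})"
        using y(2) by (simp add: Y_def cong: image_cong_simp)
      show "bounded (Y ` {0..T})"
        by (intro compact_imp_bounded compact_continuous_image continuous_on_subset[OF Y_cont]) auto
    qed
    then have "bounded ((\<lambda>x. exp (drift \<omega> T) *\<^sub>R x) ` (Y ` {..0} \<union> Y ` {0..T}))"
      by (rule bounded_scaling)
    moreover have "y' ` {..0} \<subseteq> (\<lambda>x. exp (drift \<omega> T) *\<^sub>R x) ` (Y ` {..0} \<union> Y ` {0..T})"
    proof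
      fix z assume "z \<in> y' ` {..0}"
      then obtain \<sigma> where "\<sigma> \<le> 0" "z = exp (drift \<omega> T) *\<^sub>R Y (\<sigma> + T)"
        by (auto simp: y'_def)
      moreover from this have "\<sigma> + T \<in> {..0} \<union> {0..T}"
        by auto
      ultimately show "z \<in> (\<lambda>x. exp (drift \<omega> T) *\<^sub>R x) ` (Y ` {..0} \<union> Y ` {0..T})"
        by blast
    qed
    ultimately show ?thesis
      by (rule bounded_subset)
  qed
  moreover have "y' 0 = w T"
    using Y_w[OF T] by (simp add: y'_def)
  moreover have "mild_step S_resc (\<lambda>\<sigma>. nonlin (shift T \<omega>) \<sigma> (y' \<sigma>)) y' s t" if "s \<le> t" for s t
    unfolding y'_def by (rule mild_step_shift[OF \<omega> that mild]) (use that in simp)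
  ultimately show ?thesis
    by (auto simp: M_u_eq_bounded_backward_orbits[OF shift_in[OF \<omega>]] bounded_backward_orbits_def)
qed

section \<open>The random unstable manifold\<close>

abbreviation path_space :: "(real \<Rightarrow> real) measure" where
  "path_space \<equiv> restrict_space W \<Omega>"

lemma space_path_space [simp]: "space path_space = \<Omega>"
  using paths sets.sets_into_space[of \<Omega> W] by (auto simp: noise_paths_def space_restrict_space)

lemma measurable_z_joint [measurable]:
  "(\<lambda>p. z_OU (shift (fst p) (snd p))) \<in> borel_measurable (borel \<Otimes>\<^sub>M path_space)"
  by (rule measurable_Caratheodory[of "\<lambda>t \<omega>. z_OU (shift t \<omega>)"])
    (simp_all add: continuous_z measurable_restrict_space1[OF measurable_z_shift[OF wiener]])

lemma measurable_drift: "(\<lambda>\<omega>. drift \<omega> t) \<in> borel_measurable path_space"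
proof -
  have swap: "(\<lambda>p. (snd p, fst p)) \<in> path_space \<Otimes>\<^sub>M lborel \<rightarrow>\<^sub>M (borel :: real measure) \<Otimes>\<^sub>M path_space"
    by measurable
  from measurable_compose[OF swap measurable_z_joint]
  have [measurable]: "(\<lambda>p. z_OU (shift (snd p) (fst p))) \<in> borel_measurable (path_space \<Otimes>\<^sub>M lborel)"
    by simp
  have [measurable]: "(\<lambda>\<omega>. \<integral>r. indicator (einterval a b) r *\<^sub>R z_OU (shift r \<omega>) \<partial>lborel) \<in> borel_measurable path_space"
    for a b
    by (rule lborel.borel_measurable_lebesgue_integral) (unfold split_beta, measurable)
  show ?thesis
    unfolding drift_def interval_lebesgue_integral_def set_lebesgue_integral_def by measurable
qed

lemma measurable_drift_joint [measurable]:
  "(\<lambda>p. drift (snd p) (fst p)) \<in> borel_measurable (borel \<Otimes>\<^sub>M path_space)"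
  by (rule measurable_Caratheodory[of "\<lambda>t \<omega>. drift \<omega> t"]) (simp_all add: measurable_drift continuous_drift)

lemma measurable_nonlin:
  assumes [measurable]: "y \<in> borel_measurable (borel \<Otimes>\<^sub>M path_space)"
  shows "(\<lambda>p. nonlin (snd p) (fst p) (y p)) \<in> borel_measurable (borel \<Otimes>\<^sub>M path_space)"
proof -
  have [measurable]: "F \<in> borel_measurable borel"
    by (rule borel_measurable_continuous_onI[OF continuous_F])
  show ?thesis
    unfolding nonlin_def Let_def by measurable
qed

definition h_u :: "'a \<Rightarrow> (real \<Rightarrow> real) \<Rightarrow> 'a" where
  "h_u \<xi> \<omega> = graph_map (nonlin \<omega>) \<xi>"

lemma measurable_h_u: "h_u \<xi> \<in> borel_measurable path_space"
  unfolding h_u_def[abs_def]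
  by (rule measurable_graph_map[OF measurable_nonlin admissible_nonlin contraction_less_1]) simp_all

lemma h_u_0: "\<omega> \<in> \<Omega> \<Longrightarrow> h_u 0 \<omega> = 0"
  unfolding h_u_def by (rule graph_map_0[OF admissible_nonlin contraction_less_1])

lemma lipschitz_graph_M_u:
  assumes "\<omega> \<in> \<Omega>"
  shows "lipschitz_graph (range P) (range (\<lambda>x. x - P x)) (\<lambda>\<xi>. h_u \<xi> \<omega>) (M_u S F \<eta> \<omega>)"
  unfolding h_u_def M_u_eq_bounded_backward_orbits[OF assms]
  by (rule lipschitz_graph_bounded_backward_orbits[OF admissible_nonlin[OF assms] contraction_less_1])

lemma M_u_dense_section:
  assumes \<omega>: "\<omega> \<in> \<Omega>" and D: "closure D = (UNIV :: 'a set)"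
  shows "M_u S F \<eta> \<omega> = closure ((\<lambda>d. P d + h_u (P d) \<omega>) ` D)"
proof -
  note g = lipschitz_graph_M_u[OF \<omega>, unfolded lipschitz_graph_def]
  then obtain C where "C-lipschitz_on (range P) (\<lambda>\<xi>. h_u \<xi> \<omega>)"
    by blast
  from closure_graph[OF lin_P P_P this _ D] g show ?thesis
    by simp
qed

lemma countable_dense: "\<exists>D :: 'a set. countable D \<and> D \<noteq> {} \<and> closure D = UNIV"
proof -
  obtain D :: "'a set" where D: "countable D" "\<And>X. open X \<Longrightarrow> X \<noteq> {} \<Longrightarrow> \<exists>d\<in>D. d \<in> X"
    using countable_dense_setE by blast
  have "closure D = UNIV"
    using D(2)[of "- closure D"] closure_subset[of D] by (auto simp: open_Compl)
  moreover have "D \<noteq> {}"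
    using D(2)[of UNIV] by auto
  ultimately show ?thesis
    using D(1) by blast
qed

lemma random_set_M_u: "random_set path_space (M_u S F \<eta>)"
proof -
  obtain D :: "'a set" where D: "countable D" "D \<noteq> {}" "closure D = UNIV"
    using countable_dense by blast
  have "(\<lambda>\<omega>. P d + h_u (P d) \<omega>) \<in> borel_measurable path_space" for d
    using measurable_h_u by (intro borel_measurable_add borel_measurable_const)
  then show ?thesis
    by (rule random_set_Castaing[OF D(1,2)]) (simp add: M_u_dense_section[OF _ D(3)])
qed

lemma measurable_z: "z_OU \<in> borel_measurable path_space"
proof -
  have "z_OU (shift 0 \<omega>) = z_OU \<omega>" if "\<omega> \<in> \<Omega>" for \<omega>
  proof -
    have "\<omega> \<in> C0"
      using that paths wiener sets.sets_into_space[of \<Omega> W] by (auto simp: noise_paths_def wiener_measure_def)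
    then show ?thesis
      by (simp add: shift_def C0_def)
  qed
  then show ?thesis
    using measurable_restrict_space1[OF measurable_z_shift[OF wiener, of 0], of \<Omega>]
    by (subst measurable_cong[of _ _ "\<lambda>\<omega>. z_OU (shift 0 \<omega>)"]) simp_all
qed

lemma random_set_T_inv_M_u: "random_set path_space (\<lambda>\<omega>. T_inv \<omega> ` M_u S F \<eta> \<omega>)"
proof -
  obtain D :: "'a set" where D: "countable D" "D \<noteq> {}" "closure D = UNIV"
    using countable_dense by blast
  have "(\<lambda>\<omega>. T_inv \<omega> (P d + h_u (P d) \<omega>)) \<in> borel_measurable path_space" for d
    unfolding T_inv_def
    using measurable_h_u measurable_compose[OF measurable_z borel_measurable_exp]
    by (intro borel_measurable_scaleR borel_measurable_add borel_measurable_const)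
  then show ?thesis
  proof (rule random_set_Castaing[OF D(1,2)])
    fix \<omega> assume "\<omega> \<in> space path_space"
    then have "T_inv \<omega> ` M_u S F \<eta> \<omega> = (*\<^sub>R) (exp (z_OU \<omega>)) ` closure ((\<lambda>d. P d + h_u (P d) \<omega>) ` D)"
      using M_u_dense_section[OF _ D(3)] by (simp add: T_inv_def[abs_def])
    then show "T_inv \<omega> ` M_u S F \<eta> \<omega> = closure ((\<lambda>d. T_inv \<omega> (P d + h_u (P d) \<omega>)) ` D)"
      by (simp add: closure_scaleR image_image T_inv_def)
  qed
qed

text \<open>A homothety maps the graph of \<open>h\<close> to the graph of \<open>h\<close> conjugated by it, with the same Lipschitz constant.\<close>
lemma lipschitz_graph_T_inv_M_u:
  assumes "\<omega> \<in> \<Omega>"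
  shows "lipschitz_graph (range P) (range (\<lambda>x. x - P x))
    (\<lambda>\<xi>. T_inv \<omega> (h_u (T_map \<omega> \<xi>) \<omega>)) (T_inv \<omega> ` M_u S F \<eta> \<omega>)"
proof -
  have "k *\<^sub>R x \<in> range P" if "x \<in> range P" for k x
    using that by (simp add: in_range_P)
  moreover have "k *\<^sub>R x \<in> range (\<lambda>x. x - P x)" if "x \<in> range (\<lambda>x. x - P x)" for k x
  proof -
    from that obtain y where "x = y - P y"
      by blast
    then have "k *\<^sub>R x = k *\<^sub>R y - P (k *\<^sub>R y)"
      by (simp add: scaleR_diff_right)
    then show ?thesis
      by blast
  qed
  ultimately show ?thesis
    using lipschitz_graph_scaleR[OF lipschitz_graph_M_u[OF assms] exp_gt_zero, of "z_OU \<omega>"]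
    by (simp add: T_inv_def[abs_def] T_map_def exp_minus)
qed

end

theorem theorem5p1:
  fixes D :: "'a::{real_inner, banach, second_countable_topology} set"
    and A :: "'a \<Rightarrow> 'a"
    and S :: "real \<Rightarrow> 'a \<Rightarrow> 'a"
    and P F :: "'a \<Rightarrow> 'a"
    and u :: "real \<Rightarrow> (real \<Rightarrow> real) \<Rightarrow> 'a \<Rightarrow> 'a"
    and W :: "(real \<Rightarrow> real) measure"
    and \<Omega> :: "(real \<Rightarrow> real) set"
    and \<alpha> \<beta> \<eta> K LipF :: real
  assumes infinite_dim: "\<nexists>B::'a set. finite B \<and> span B = UNIV"
    and generator: "generates D A S"
    and dichotomy: "exponential_dichotomy S P \<alpha> \<beta> K"
    and F_0: "F 0 = 0"
    and F_Lip: "LipF > 0"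
      "\<And>x1 x2. norm (P (F x1 - F x2)) \<le> LipF * norm (x1 - x2)"
      "\<And>x1 x2. norm ((F x1 - F x2) - P (F x1 - F x2)) \<le> LipF * norm (x1 - x2)"
    and wiener: "wiener_measure W"
    and paths: "noise_paths W \<Omega>"
    and u_solution: "\<And>\<omega> u0. \<omega> \<in> \<Omega> \<Longrightarrow> forward_mild_solution S F \<omega> u0 (\<lambda>t. u t \<omega> u0)"
    and u_unique: "\<And>\<omega> u0 v t. \<omega> \<in> \<Omega> \<Longrightarrow> forward_mild_solution S F \<omega> u0 v \<Longrightarrow> t \<ge> 0 \<Longrightarrow> v t = u t \<omega> u0"
    and u_rds: "random_dynamical_system (restrict_space W \<Omega>) u"
    and eta: "\<beta> < \<eta>" "\<eta> < \<alpha>"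
    and gap: "K * LipF * (1 / (\<eta> - \<beta>) + 1 / (\<alpha> - \<eta>)) < 1"
  shows "lipschitz_unstable_manifold (restrict_space W \<Omega>) (range P) (range (\<lambda>x. x - P x))
           u (M_u S F \<eta>) \<and>
         (\<exists>h. \<forall>\<omega>\<in>\<Omega>.
            lipschitz_graph (range P) (range (\<lambda>x. x - P x)) (\<lambda>\<xi>. h \<xi> \<omega>) (M_u S F \<eta> \<omega>) \<and>
            h 0 \<omega> = 0) \<and>
         lipschitz_unstable_manifold (restrict_space W \<Omega>) (range P) (range (\<lambda>x. x - P x))
           (u_hat u) (\<lambda>\<omega>. T_inv \<omega> ` M_u S F \<eta> \<omega>)"
proof -
  \<comment> \<open>By infinite dimension there is a nonzero vector, for which the dichotomy bound at time \<open>0\<close> gives \<open>K \<ge> 0\<close>.\<close>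
  have "K \<ge> 0"
  proof -
    obtain x :: 'a where "x \<noteq> 0"
      using infinite_dim by (metis UNIV_eq_I finite.emptyI insertI1 span_empty singletonD)
    have "0 \<le> norm (S 0 (x - P x))"
      by simp
    also have "norm (S 0 (x - P x)) \<le> K * exp (\<beta> * 0) * norm x"
      using dichotomy unfolding exponential_dichotomy_def by blast
    finally show ?thesis
      using \<open>x \<noteq> 0\<close> by (simp add: zero_le_mult_iff)
  qed
  moreover have "strongly_continuous_semigroup S"
    using generator by (simp add: generates_def)
  ultimately interpret random_equation S P F \<alpha> \<beta> K LipF \<eta> W \<Omega>
    using F_Lip(1) by unfold_locales (rule assms | simp)+
  have invariant: "u t \<omega> x \<in> M_u S F \<eta> (shift t \<omega>)" if "\<omega> \<in> \<Omega>" "t \<ge> 0" "x \<in> M_u S F \<eta> \<omega>" for \<omega> t x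
    by (rule M_u_invariant[OF that u_solution[OF that(1)]])
  have "u_hat u t \<omega> (T_inv \<omega> x) = T_inv (shift t \<omega>) (u t \<omega> x)" for t \<omega> x
    by (simp add: u_hat_def T_map_def T_inv_def exp_add[symmetric])
  then have invariant_hat: "u_hat u t \<omega> ` T_inv \<omega> ` M_u S F \<eta> \<omega> \<subseteq> T_inv (shift t \<omega>) ` M_u S F \<eta> (shift t \<omega>)"
    if "\<omega> \<in> \<Omega>" "t \<ge> 0" for \<omega> t
    using invariant[OF that] by auto
  have "lipschitz_unstable_manifold path_space (range P) (range (\<lambda>x. x - P x)) u (M_u S F \<eta>)"
    unfolding lipschitz_unstable_manifold_def invariant_random_set_def
    using random_set_M_u invariant lipschitz_graph_M_u by (auto intro!: exI[of _ h_u])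
  moreover have "\<forall>\<omega>\<in>\<Omega>. lipschitz_graph (range P) (range (\<lambda>x. x - P x)) (\<lambda>\<xi>. h_u \<xi> \<omega>) (M_u S F \<eta> \<omega>) \<and> h_u 0 \<omega> = 0"
    using lipschitz_graph_M_u h_u_0 by blast
  moreover have "lipschitz_unstable_manifold path_space (range P) (range (\<lambda>x. x - P x))
      (u_hat u) (\<lambda>\<omega>. T_inv \<omega> ` M_u S F \<eta> \<omega>)"
    unfolding lipschitz_unstable_manifold_def invariant_random_set_def space_path_space
    by (intro conjI exI[of _ "\<lambda>\<xi> \<omega>. T_inv \<omega> (h_u (T_map \<omega> \<xi>) \<omega>)"] ballI allI impI
        random_set_T_inv_M_u invariant_hat lipschitz_graph_T_inv_M_u)
  ultimately show ?thesis
    by blast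
qed

end
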